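(* Let $p\ge1$, $H=(H_1,\dots,H_p)\in(0,1)^p$ and $\sigma_1,\dots,\sigma_p>0$. For $i,j\in\{1,\dots,p\}$ let there be given: if $H_i+H_j\ne1$, real numbers $\rho_{i,j}\in[-1,1]$, $\eta_{i,j}\in\mathbb{R}$ with $\rho_{j,i}=\rho_{i,j}$, $\eta_{j,i}=-\eta_{i,j}$; if $H_i+H_j=1$, real numbers $\tilde\rho_{i,j}\in[-1,1]$, $\tilde\eta_{i,j}\in\mathbb{R}$ with $\tilde\rho_{j,i}=\tilde\rho_{i,j}$, $\tilde\eta_{j,i}=-\tilde\eta_{i,j}$; with $\rho_{i,i}=1$, $\eta_{i,i}=0$ (respectively $\tilde\rho_{i,i}=1$, $\tilde\eta_{i,i}=0$ when $2H_i=1$). For $s,t\in\mathbb{R}$ let $\Sigma(s,t)=(\Sigma_{i,j}(s,t))_{1\le i,j\le p}$ be defined by $$\Sigma_{i,i}(s,t)=\tfrac{\sigma_i^2}{2}\{|s|^{2H_i}+|t|^{2H_i}-|t-s|^{2H_i}\}$$ and, for $i\neq j$, $$\Sigma_{i,j}(s,t)=\tfrac{\sigma_i\sigma_j}{2}\big\{(\rho_{i,j}+\eta_{i,j}\mathrm{sign}(s))|s|^{H_i+H_j}+(\rho_{i,j}-\eta_{i,j}\mathrm{sign}(t))|t|^{H_i+H_j}-(\rho_{i,j}-\eta_{i,j}\mathrm{sign}(t-s))|t-s|^{H_i+H_j}\big\}$$ if $H_i+H_j\neq1$, and $$\Sigma_{i,j}(s,t)=\tfrac{\sigma_i\sigma_j}{2}\big\{\tilde\rho_{i,j}(|s|+|t|-|s-t|)+\tilde\eta_{i,j}(t\log|t|-s\log|s|-(t-s)\log|t-s|)\big\}$$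 if $H_i+H_j=1$ (with $0\log 0=0$). Then $\Sigma(s,t)$ is a covariance matrix function if and only if the Hermitian matrix $$Q=\big(\Gamma(H_i+H_j+1)\,\tau_{i,j}\big)_{1\le i,j\le p},\qquad \tau_{i,j}=\begin{cases}\rho_{i,j}\sin\!\big(\tfrac{\pi}{2}(H_i+H_j)\big)-\mathbf{i}\,\eta_{i,j}\cos\!\big(\tfrac{\pi}{2}(H_i+H_j)\big) & \text{if } H_i+H_j\neq1,\\ \tilde\rho_{i,j}-\mathbf{i}\,\tfrac{\pi}{2}\tilde\eta_{i,j} & \text{if } H_i+H_j=1,\end{cases}$$ is positive semidefinite. When $p=2$, this condition reduces to $C_{1,2}\le1$, where $$C_{1,2}=\frac{\Gamma(H_1+H_2+1)^2}{\Gamma(2H_1+1)\Gamma(2H_2+1)}\cdot\frac{\rho_{1,2}^2\sin^2\!\big(\tfrac{\pi}{2}(H_1+H_2)\big)+\eta_{1,2}^2\cos^2\!\big(\tfrac{\pi}{2}(H_1+H_2)\big)}{\sin(\pi H_1)\sin(\pi H_2)}$$ if $H_1+H_2\neq1$, and the same formula with the numerator $\rho_{1,2}^2\sin^2(\cdot)+\eta_{1,2}^2\cos^2(\cdot)$ replaced by $\tilde\rho_{1,2}^2+\tfrac{\pi^2}{4}\tilde\eta_{1,2}^2$ if $H_1+H_2=1$.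
   Context: $\mathbf{i}$ denotes the imaginary unit and $\Gamma$ the Gamma function. "$\Sigma(s,t)$ is a covariance matrix function" means that there exists an $\mathbb{R}^p$-valued (zero-mean, Gaussian) process $(X(t))_{t\in\mathbb{R}}$ with $\mathbb{E}X_i(s)X_j(t)=\Sigma_{i,j}(s,t)$ for all $i,j$ and $s,t\in\mathbb{R}$; equivalently, $\sum_{k,l}u_k'\,\Sigma(t_k,t_l)\,u_l\ge0$ for all finite families $t_k\in\mathbb{R}$, $u_k\in\mathbb{R}^p$. *)

theory Defs
  imports "HOL-Probability.Probability"
begin

section \<open>Covariance matrix functions\<close>

text \<open>The second disjunct is the degenerate normal law with variance \<open>0\<close>.\<close>

definition centered_normal :: "'w measure \<Rightarrow> ('w \<Rightarrow> real) \<Rightarrow> bool" where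
  "centered_normal M Y \<longleftrightarrow>
     Y \<in> borel_measurable M \<and>
     ((\<exists>s>0. distributed M lborel Y (normal_density 0 s)) \<or> (AE \<omega> in M. Y \<omega> = 0))"

definition centered_gaussian_process ::
    "'w measure \<Rightarrow> (real \<Rightarrow> 'w \<Rightarrow> real ^ 'n::finite) \<Rightarrow> bool" where
  "centered_gaussian_process M X \<longleftrightarrow>
     prob_space M \<and>
     (\<forall>t. X t \<in> borel_measurable M) \<and>
     (\<forall>T u. finite T \<longrightarrow> centered_normal M (\<lambda>\<omega>. \<Sum>t\<in>T. u t \<bullet> X t \<omega>))"

definition has_covariance ::
    "'w measure \<Rightarrow> (real \<Rightarrow> 'w \<Rightarrow> real ^ 'n::finite) \<Rightarrow> (real \<Rightarrow> real \<Rightarrow> real ^ 'n ^ 'n) \<Rightarrow> bool" where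
  "has_covariance M X S \<longleftrightarrow>
     (\<forall>i j s t. has_bochner_integral M (\<lambda>\<omega>. X s \<omega> $ i * X t \<omega> $ j) (S s t $ i $ j))"

text \<open>
  HOL cannot quantify over the type of the sample space, so it is fixed to be the type of paths
  \<open>real \<Rightarrow> real ^ 'n\<close>. This is no restriction: the lemma \<open>covariance_matrix_functionI\<close> below
  covers a process on an arbitrary probability space.
\<close>

definition covariance_matrix_function :: "(real \<Rightarrow> real \<Rightarrow> real ^ 'n::finite ^ 'n) \<Rightarrow> bool" where
  "covariance_matrix_function S \<longleftrightarrow>
     (\<exists>(M :: (real \<Rightarrow> real ^ 'n) measure) X. centered_gaussian_process M X \<and> has_covariance M X S)"

lemma covariance_matrix_functionI:
  fixes M :: "'w measure" and X :: "real \<Rightarrow> 'w \<Rightarrow> real ^ 'n::finite"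
  assumes gp: "centered_gaussian_process M X" and cov: "has_covariance M X S"
  shows "covariance_matrix_function S"
proof -
  define P where "P = (\<Pi>\<^sub>M t\<in>(UNIV :: real set). (borel :: (real ^ 'n) measure))"
  define F where "F = (\<lambda>\<omega> t. X t \<omega>)"
  define N where "N = distr M P F"
  define Y :: "real \<Rightarrow> (real \<Rightarrow> real ^ 'n) \<Rightarrow> real ^ 'n" where "Y = (\<lambda>t f. f t)"
  interpret prob_space M
    using gp by (simp add: centered_gaussian_process_def)
  have X: "X t \<in> borel_measurable M" for t
    using gp by (simp add: centered_gaussian_process_def)
  have F: "F \<in> measurable M P"
    unfolding F_def P_def by (rule measurable_PiM_single') (auto simp: X)
  have Y: "Y t \<in> borel_measurable P" for t
    unfolding Y_def P_def by measurable
  have YN: "Y t \<in> borel_measurable N" for t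
    using Y by (simp add: N_def)
  have YF: "Y t (F \<omega>) = X t \<omega>" for t \<omega>
    by (simp add: Y_def F_def)
  have "prob_space N"
    unfolding N_def by (rule prob_space_distr[OF F])
  moreover have "centered_normal N (\<lambda>\<omega>. \<Sum>t\<in>T. u t \<bullet> Y t \<omega>)" if "finite T" for T u
  proof -
    have Z: "(\<lambda>\<omega>. \<Sum>t\<in>T. u t \<bullet> Y t \<omega>) \<in> borel_measurable P"
      using Y by measurable
    have ZN: "(\<lambda>\<omega>. \<Sum>t\<in>T. u t \<bullet> Y t \<omega>) \<in> borel_measurable N"
      using Z by (simp add: N_def)
    have d: "distr N lborel (\<lambda>\<omega>. \<Sum>t\<in>T. u t \<bullet> Y t \<omega>) = distr M lborel (\<lambda>\<omega>. \<Sum>t\<in>T. u t \<bullet> X t \<omega>)"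
      unfolding N_def using Z F by (subst distr_distr) (auto simp: o_def YF)
    have a: "(AE \<omega> in N. (\<Sum>t\<in>T. u t \<bullet> Y t \<omega>) = 0) \<longleftrightarrow> (AE \<omega> in M. (\<Sum>t\<in>T. u t \<bullet> X t \<omega>) = 0)"
      unfolding N_def using Z F by (subst AE_distr_iff) (auto simp: YF)
    have "centered_normal M (\<lambda>\<omega>. \<Sum>t\<in>T. u t \<bullet> X t \<omega>)"
      using gp that by (simp add: centered_gaussian_process_def)
    then show ?thesis
      using ZN by (auto simp: centered_normal_def distributed_def d a)
  qed
  ultimately have "centered_gaussian_process N Y"
    using YN by (simp add: centered_gaussian_process_def)
  moreover have "has_covariance N Y S"
    unfolding has_covariance_def
  proof (intro allI)
    fix i j s t
    have "(\<lambda>\<omega>. Y r \<omega> $ k) \<in> borel_measurable P" for r k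
      by (rule measurable_compose[OF Y borel_measurable_continuous_onI])
        (intro continuous_intros)
    then have "(\<lambda>\<omega>. Y s \<omega> $ i * Y t \<omega> $ j) \<in> borel_measurable P"
      by (intro borel_measurable_times)
    then show "has_bochner_integral N (\<lambda>\<omega>. Y s \<omega> $ i * Y t \<omega> $ j) (S s t $ i $ j)"
      using cov F unfolding N_def has_covariance_def
      by (simp add: has_bochner_integral_iff integrable_distr_eq integral_distr YF)
  qed
  ultimately show ?thesis
    unfolding covariance_matrix_function_def by blast
qed


section \<open>Hermitian and positive semidefinite matrices\<close>

definition hermitian :: "complex ^ 'n ^ 'n \<Rightarrow> bool" where
  "hermitian A \<longleftrightarrow> (\<forall>i j. A $ j $ i = cnj (A $ i $ j))"

definition positive_semidefinite :: "complex ^ 'n::finite ^ 'n \<Rightarrow> bool" where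
  "positive_semidefinite A \<longleftrightarrow>
     hermitian A \<and>
     (\<forall>v :: complex ^ 'n. 0 \<le> Re (\<Sum>i\<in>UNIV. \<Sum>j\<in>UNIV. cnj (v $ i) * A $ i $ j * v $ j))"


section \<open>The covariance function of multivariate fractional Brownian motion\<close>

text \<open>
  The parameters \<open>\<rho>\<close>, \<open>\<eta>\<close> are used for pairs with \<open>H i + H j \<noteq> 1\<close> and \<open>\<rho>'\<close>, \<open>\<eta>'\<close> (the
  parameters with a tilde) for pairs with \<open>H i + H j = 1\<close>; the values at the other pairs are
  irrelevant. The conventions \<open>0 powr a = 0\<close> and \<open>0 * ln 0 = 0\<close> hold by definition.
\<close>

definition mfbm_cov ::
    "('n \<Rightarrow> real) \<Rightarrow> ('n \<Rightarrow> real) \<Rightarrow> ('n \<Rightarrow> 'n \<Rightarrow> real) \<Rightarrow> ('n \<Rightarrow> 'n \<Rightarrow> real) \<Rightarrow>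
     ('n \<Rightarrow> 'n \<Rightarrow> real) \<Rightarrow> ('n \<Rightarrow> 'n \<Rightarrow> real) \<Rightarrow> real \<Rightarrow> real \<Rightarrow> real ^ 'n::finite ^ 'n" where
  "mfbm_cov H \<sigma> \<rho> \<eta> \<rho>' \<eta>' s t = (\<chi> i j.
     if i = j then
       (\<sigma> i)\<^sup>2 / 2 * (\<bar>s\<bar> powr (2 * H i) + \<bar>t\<bar> powr (2 * H i) - \<bar>t - s\<bar> powr (2 * H i))
     else if H i + H j \<noteq> 1 then
       \<sigma> i * \<sigma> j / 2 *
         ((\<rho> i j + \<eta> i j * sgn s) * \<bar>s\<bar> powr (H i + H j)
          + (\<rho> i j - \<eta> i j * sgn t) * \<bar>t\<bar> powr (H i + H j)
          - (\<rho> i j - \<eta> i j * sgn (t - s)) * \<bar>t - s\<bar> powr (H i + H j))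
     else
       \<sigma> i * \<sigma> j / 2 *
         (\<rho>' i j * (\<bar>s\<bar> + \<bar>t\<bar> - \<bar>s - t\<bar>)
          + \<eta>' i j * (t * ln \<bar>t\<bar> - s * ln \<bar>s\<bar> - (t - s) * ln \<bar>t - s\<bar>)))"

definition mfbm_tau ::
    "('n \<Rightarrow> real) \<Rightarrow> ('n \<Rightarrow> 'n \<Rightarrow> real) \<Rightarrow> ('n \<Rightarrow> 'n \<Rightarrow> real) \<Rightarrow>
     ('n \<Rightarrow> 'n \<Rightarrow> real) \<Rightarrow> ('n \<Rightarrow> 'n \<Rightarrow> real) \<Rightarrow> 'n \<Rightarrow> 'n \<Rightarrow> complex" where
  "mfbm_tau H \<rho> \<eta> \<rho>' \<eta>' i j =
     (if H i + H j \<noteq> 1 then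
        complex_of_real (\<rho> i j * sin (pi / 2 * (H i + H j)))
        - \<i> * complex_of_real (\<eta> i j * cos (pi / 2 * (H i + H j)))
      else
        complex_of_real (\<rho>' i j) - \<i> * complex_of_real (pi / 2 * \<eta>' i j))"

definition mfbm_Q ::
    "('n \<Rightarrow> real) \<Rightarrow> ('n \<Rightarrow> 'n \<Rightarrow> real) \<Rightarrow> ('n \<Rightarrow> 'n \<Rightarrow> real) \<Rightarrow>
     ('n \<Rightarrow> 'n \<Rightarrow> real) \<Rightarrow> ('n \<Rightarrow> 'n \<Rightarrow> real) \<Rightarrow> complex ^ 'n::finite ^ 'n" where
  "mfbm_Q H \<rho> \<eta> \<rho>' \<eta>' =
     (\<chi> i j. complex_of_real (Gamma (H i + H j + 1)) * mfbm_tau H \<rho> \<eta> \<rho>' \<eta>' i j)"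

definition mfbm_C ::
    "('n \<Rightarrow> real) \<Rightarrow> ('n \<Rightarrow> 'n \<Rightarrow> real) \<Rightarrow> ('n \<Rightarrow> 'n \<Rightarrow> real) \<Rightarrow>
     ('n \<Rightarrow> 'n \<Rightarrow> real) \<Rightarrow> ('n \<Rightarrow> 'n \<Rightarrow> real) \<Rightarrow> 'n \<Rightarrow> 'n \<Rightarrow> real" where
  "mfbm_C H \<rho> \<eta> \<rho>' \<eta>' i j =
     (Gamma (H i + H j + 1))\<^sup>2 / (Gamma (2 * H i + 1) * Gamma (2 * H j + 1)) *
     ((if H i + H j \<noteq> 1 then
         (\<rho> i j)\<^sup>2 * (sin (pi / 2 * (H i + H j)))\<^sup>2 + (\<eta> i j)\<^sup>2 * (cos (pi / 2 * (H i + H j)))\<^sup>2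
       else
         (\<rho>' i j)\<^sup>2 + pi\<^sup>2 / 4 * (\<eta>' i j)\<^sup>2)
      / (sin (pi * H i) * sin (pi * H j)))"

end

theory Submission
  imports Defs "HOL-Real_Asymp.Real_Asymp"
begin

text \<open>
  The entries of the covariance have a spectral representation with density built from \<open>Q\<close>:
  with \<open>h = H i + H j\<close>,
  \[ \Sigma_{i,j}(s,t) = \frac{\sigma_i \sigma_j}{\pi} \int_0^\infty
       \mathrm{Re}\big(\overline{(1 - e^{isx})}\, Q_{i,j}\, (1 - e^{itx})\big)\, x^{-h-1}\, dx . \]
  It is obtained by writing \<open>\<Gamma>(h + 1) x powr (-h - 1)\<close> as the integral of
  \<open>y powr h * exp (- x * y)\<close> over \<open>y\<close> and exchanging the integrals. The inner Laplace transforms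
  of the trigonometric kernel are rational functions of \<open>y\<close>, whose integrals against a power of
  \<open>y\<close> are evaluated by the reflection formula. In the real part of the kernel every term
  converges separately. In the imaginary part only the combination of the three sines converges
  for all \<open>h\<close>; because the three frequencies cancel, a term \<open>u * r y\<close> linear in the frequency can be
  subtracted from each of them, and the choice of \<open>r\<close> that restores convergence is what separates the
  cases \<open>h < 1\<close>, \<open>h > 1\<close> and \<open>h = 1\<close>, the last one producing the logarithm
  (lemma \<open>spectral_representation\<close>).

  If \<open>Q\<close> is positive semidefinite, every quadratic form in the covariance is the integral
  of a nonnegative function. A Gaussian process then has to be constructed. A positive semidefinite
  kernel that is continuous along a countable family \<open>d\<close> of indices is a sum
  \<open>K x y = (\<Sum>k. a x k * a y k)\<close>: eliminating the indices \<open>d 0, d 1, \<dots>\<close> one after the other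
  (an infinite Cholesky decomposition) leaves positive semidefinite remainders that vanish on the
  eliminated indices and hence, by continuity, tend to 0 (\<open>psd_kernel_expansion\<close>). With independent
  standard normal \<open>\<xi> k\<close>, the series \<open>\<Sum>k. a x k * \<xi> k\<close> converges in mean, and its finite linear
  combinations are identified as normal by their characteristic functions
  (\<open>gaussian_family_of_square_summable\<close>).

  Conversely, the quadratic form of a covariance is nonnegative already for second moments. Testing
  it with the trigonometric polynomials \<open>(1 - exp (i pi x)) * cos (sqrt (T / n) * (x - 1)) ^ n\<close>,
  times a vector \<open>v\<close>, and letting \<open>n\<close> tend to infinity replaces the power of the cosine by a Gaussian
  centred at frequency 1; letting \<open>T\<close> tend to infinity isolates the spectral density there, which is
  a positive multiple of the Hermitian form of \<open>Q\<close> at \<open>v\<close> (\<open>spectral_form_at_1_nonneg\<close>).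
  The condition for two components is the determinant criterion for two-by-two matrices.
\<close>

section \<open>Gaussian random variables via characteristic functions\<close>

text \<open>
  Normality is expressed by the characteristic function, because this covers the degenerate case
  \<open>v = 0\<close> as well and is stable under limits in mean.
\<close>

definition gaussian_char :: "'w measure \<Rightarrow> real \<Rightarrow> ('w \<Rightarrow> real) \<Rightarrow> bool" where
  "gaussian_char M v Y \<longleftrightarrow> Y \<in> borel_measurable M \<and>
     (\<forall>t. (CLINT \<omega>|M. iexp (t * Y \<omega>)) = complex_of_real (exp (- (v * t\<^sup>2) / 2)))"

lemma char_eq_integral:
  assumes "Y \<in> borel_measurable M"
  shows "char (distr M borel Y) t = (CLINT \<omega>|M. iexp (t * Y \<omega>))"
  unfolding char_def using assms by (subst integral_distr) auto

lemma char_normal_density: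
  assumes s: "0 < s"
  shows "char (density lborel (normal_density 0 s)) t = complex_of_real (exp (- (s\<^sup>2 * t\<^sup>2) / 2))"
proof -
  interpret N: prob_space "density lborel (normal_density 0 s)"
    by (rule prob_space_normal_density[OF s])
  let ?N = "density lborel (normal_density 0 s)"
  have "distributed ?N lborel (\<lambda>x. x) (normal_density 0 s)"
    by (auto simp: distributed_def distr_id2)
  then have "distributed ?N lborel (\<lambda>x. x / s) std_normal_density"
    using N.normal_standard_normal_convert[OF s, of "\<lambda>x. x" 0] by simp
  then have d: "distr ?N borel (\<lambda>x. x / s) = density lborel std_normal_density"
    by (metis distr_cong distributed_distr_eq_density sets_lborel)
  have "char ?N t = (CLINT x|?N. iexp ((t * s) * (x / s)))"
    unfolding char_def using s by simp
  also have "\<dots> = char std_normal_distribution (t * s)"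
    unfolding d[symmetric] by (subst char_eq_integral) auto
  also have "\<dots> = complex_of_real (exp (- (s\<^sup>2 * t\<^sup>2) / 2))"
    by (simp add: char_std_normal_distribution power_mult_distrib mult.commute)
  finally show ?thesis .
qed

context prob_space
begin

lemma gaussian_char_normal:
  assumes Y: "gaussian_char M v Y" and v: "0 < v"
  shows "distributed M lborel Y (normal_density 0 (sqrt v))"
proof -
  have [measurable]: "Y \<in> borel_measurable M" using Y by (simp add: gaussian_char_def)
  have "distr M borel Y = density lborel (normal_density 0 (sqrt v))"
  proof (rule Levy_uniqueness)
    show "real_distribution (distr M borel Y)"
      by (auto simp: real_distribution_def real_distribution_axioms_def intro!: prob_space_distr)
    show "real_distribution (density lborel (normal_density 0 (sqrt v)))"
      using prob_space_normal_density[of "sqrt v" 0] v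
      by (auto simp: real_distribution_def real_distribution_axioms_def)
    show "char (distr M borel Y) = char (density lborel (normal_density 0 (sqrt v)))"
      using Y v by (intro ext) (simp add: char_eq_integral char_normal_density gaussian_char_def)
  qed
  then show ?thesis
    unfolding distributed_def by (auto cong: distr_cong)
qed

lemma gaussian_char_zero:
  assumes Y: "gaussian_char M 0 Y"
  shows "AE \<omega> in M. Y \<omega> = 0"
proof -
  have [measurable]: "Y \<in> borel_measurable M" using Y by (simp add: gaussian_char_def)
  have "distr M borel Y = distr M borel (\<lambda>_. 0)"
  proof (rule Levy_uniqueness)
    show "real_distribution (distr M borel Y)" "real_distribution (distr M borel (\<lambda>_. 0))"
      by (auto simp: real_distribution_def real_distribution_axioms_def intro!: prob_space_distr simp del: distr_const)
    show "char (distr M borel Y) = char (distr M borel (\<lambda>_. 0))"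
      using Y by (intro ext) (simp add: char_eq_integral gaussian_char_def prob_space del: distr_const)
  qed
  moreover have "AE x in distr M borel (\<lambda>_. 0). x = (0::real)"
    by (subst AE_distr_iff) auto
  ultimately have "AE x in distr M borel Y. x = 0" by (simp only:)
  then show ?thesis by (subst (asm) AE_distr_iff) auto
qed

lemma gaussian_char_centered_normal:
  assumes "gaussian_char M v Y" "0 \<le> v"
  shows "centered_normal M Y"
proof (cases "v = 0")
  case True
  then show ?thesis
    using assms gaussian_char_zero[of Y] by (auto simp: centered_normal_def gaussian_char_def)
next
  case False
  then have "0 < v" using assms by simp
  with assms show ?thesis
    using gaussian_char_normal[of v Y] real_sqrt_gt_zero
    unfolding centered_normal_def gaussian_char_def by blast
qed

lemma gaussian_char_second_moment:
  assumes Y: "gaussian_char M v Y" and v: "0 \<le> v"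
  shows "has_bochner_integral M (\<lambda>\<omega>. (Y \<omega>)\<^sup>2) v"
proof (cases "v = 0")
  case True
  have [measurable]: "Y \<in> borel_measurable M" using Y by (simp add: gaussian_char_def)
  have "AE \<omega> in M. (Y \<omega>)\<^sup>2 = 0"
    using gaussian_char_zero[of Y] Y True by auto
  then have "has_bochner_integral M (\<lambda>\<omega>. (Y \<omega>)\<^sup>2) 0 \<longleftrightarrow> has_bochner_integral M (\<lambda>\<omega>. 0::real) 0"
    by (intro has_bochner_integral_cong_AE) auto
  then show ?thesis using True by (simp add: has_bochner_integral_zero)
next
  case False
  then have v: "0 < v" "0 < sqrt v" using v by auto
  note D = gaussian_char_normal[OF Y v(1)]
  have "has_bochner_integral lborel (\<lambda>x. normal_density 0 (sqrt v) x * x\<^sup>2) v"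
    using normal_moment_even[OF v(2), of 0 1] v by (simp add: eval_nat_numeral)
  then show ?thesis
    using distributed_integral[OF D, of "\<lambda>x. x\<^sup>2"] distributed_integrable[OF D, of "\<lambda>x. x\<^sup>2"]
    by (simp add: has_bochner_integral_iff)
qed

lemma gaussian_char_L1:
  assumes Y: "gaussian_char M v Y" and v: "0 \<le> v"
  shows "integrable M Y" "(\<integral>\<omega>. \<bar>Y \<omega>\<bar> \<partial>M) \<le> sqrt v"
proof -
  have [measurable]: "Y \<in> borel_measurable M" using Y by (simp add: gaussian_char_def)
  note m = gaussian_char_second_moment[OF assms]
  show int: "integrable M Y"
    by (rule square_integrable_imp_integrable) (use m in \<open>auto simp: has_bochner_integral_iff\<close>)
  have "0 \<le> variance (\<lambda>\<omega>. \<bar>Y \<omega>\<bar>)" by (intro integral_nonneg_AE) auto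
  also have "\<dots> = v - (\<integral>\<omega>. \<bar>Y \<omega>\<bar> \<partial>M)\<^sup>2"
    using m int by (subst variance_eq) (auto simp: has_bochner_integral_iff)
  finally show "(\<integral>\<omega>. \<bar>Y \<omega>\<bar> \<partial>M) \<le> sqrt v"
    by (simp add: real_le_rsqrt)
qed

text \<open>
  The map \<open>x \<mapsto> exp (i t x)\<close> is Lipschitz with constant \<open>\<bar>t\<bar>\<close>, so convergence in mean carries over
  to characteristic functions.
\<close>

lemma gaussian_char_L1_limit:
  assumes S: "\<And>n. gaussian_char M (v n) (S n)" "\<And>n. integrable M (S n)" and v: "v \<longlonglongrightarrow> w"
    and Y: "integrable M Y" and lim: "(\<lambda>n. \<integral>\<omega>. \<bar>S n \<omega> - Y \<omega>\<bar> \<partial>M) \<longlonglongrightarrow> 0"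
  shows "gaussian_char M w Y"
  unfolding gaussian_char_def
proof (intro conjI allI)
  show Ym: "Y \<in> borel_measurable M" using Y by auto
  have Sm: "S n \<in> borel_measurable M" for n using S by auto
  fix t
  have "(\<lambda>n. (CLINT \<omega>|M. iexp (t * S n \<omega>)) - (CLINT \<omega>|M. iexp (t * Y \<omega>))) \<longlonglongrightarrow> 0"
  proof (rule Lim_null_comparison)
    show "(\<lambda>n. \<bar>t\<bar> * (\<integral>\<omega>. \<bar>S n \<omega> - Y \<omega>\<bar> \<partial>M)) \<longlonglongrightarrow> 0"
      using tendsto_mult_left[OF lim, of "\<bar>t\<bar>"] by simp
    show "\<forall>\<^sub>F n in sequentially. norm ((CLINT \<omega>|M. iexp (t * S n \<omega>)) - (CLINT \<omega>|M. iexp (t * Y \<omega>)))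
       \<le> \<bar>t\<bar> * (\<integral>\<omega>. \<bar>S n \<omega> - Y \<omega>\<bar> \<partial>M)"
    proof (intro always_eventually allI)
      fix n
      have i: "integrable M (\<lambda>\<omega>. iexp (t * S n \<omega>))" "integrable M (\<lambda>\<omega>. iexp (t * Y \<omega>))"
        using Ym Sm by (auto intro!: integrable_iexp)
      have "norm ((CLINT \<omega>|M. iexp (t * S n \<omega>)) - (CLINT \<omega>|M. iexp (t * Y \<omega>)))
         = norm (CLINT \<omega>|M. iexp (t * S n \<omega>) - iexp (t * Y \<omega>))"
        using i by (subst Bochner_Integration.integral_diff) auto
      also have "\<dots> \<le> (\<integral>\<omega>. norm (iexp (t * S n \<omega>) - iexp (t * Y \<omega>)) \<partial>M)"
        by (rule integral_norm_bound)
      also have "\<dots> \<le> (\<integral>\<omega>. \<bar>t\<bar> * \<bar>S n \<omega> - Y \<omega>\<bar> \<partial>M)"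
      proof (rule integral_mono)
        show "integrable M (\<lambda>\<omega>. \<bar>t\<bar> * \<bar>S n \<omega> - Y \<omega>\<bar>)" using S(2) Y by auto
        fix \<omega>
        have "iexp (t * S n \<omega>) - iexp (t * Y \<omega>) = iexp (t * Y \<omega>) * (iexp (t * (S n \<omega> - Y \<omega>)) - 1)"
          by (simp add: algebra_simps flip: exp_add)
        also have "norm \<dots> = norm (iexp (t * (S n \<omega> - Y \<omega>)) - 1)"
          by (simp add: norm_mult)
        also have "\<dots> \<le> \<bar>t * (S n \<omega> - Y \<omega>)\<bar>"
          using iexp_approx1[of "t * (S n \<omega> - Y \<omega>)" 0] by simp
        finally show "norm (iexp (t * S n \<omega>) - iexp (t * Y \<omega>)) \<le> \<bar>t\<bar> * \<bar>S n \<omega> - Y \<omega>\<bar>"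
          by (simp add: abs_mult)
      qed (use i in auto)
      finally show "norm ((CLINT \<omega>|M. iexp (t * S n \<omega>)) - (CLINT \<omega>|M. iexp (t * Y \<omega>)))
         \<le> \<bar>t\<bar> * (\<integral>\<omega>. \<bar>S n \<omega> - Y \<omega>\<bar> \<partial>M)" by simp
    qed
  qed
  then have "(\<lambda>n. CLINT \<omega>|M. iexp (t * S n \<omega>)) \<longlonglongrightarrow> (CLINT \<omega>|M. iexp (t * Y \<omega>))"
    using Lim_null by blast
  moreover have "(\<lambda>n. CLINT \<omega>|M. iexp (t * S n \<omega>)) \<longlonglongrightarrow> complex_of_real (exp (- (w * t\<^sup>2) / 2))"
    using S(1) unfolding gaussian_char_def by (auto intro!: tendsto_intros v)
  ultimately show "(CLINT \<omega>|M. iexp (t * Y \<omega>)) = complex_of_real (exp (- (w * t\<^sup>2) / 2))"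
    by (rule LIMSEQ_unique)
qed

end

text \<open>
  A subsequence converges almost everywhere, and Fatou's lemma turns the Cauchy estimates into
  estimates for the distance to its limit.
\<close>

lemma L1_complete:
  fixes s :: "nat \<Rightarrow> 'a \<Rightarrow> real"
  assumes s: "\<And>n. integrable M (s n)"
    and cauchy: "\<And>e. e > 0 \<Longrightarrow> \<exists>N. \<forall>i\<ge>N. \<forall>j\<ge>N. (LINT x|M. \<bar>s i x - s j x\<bar>) < e"
  shows "\<exists>Y. integrable M Y \<and> (\<lambda>n. LINT x|M. \<bar>s n x - Y x\<bar>) \<longlonglongrightarrow> 0"
proof -
  have sm[measurable]: "s n \<in> borel_measurable M" for n using s by auto
  obtain r where r: "strict_mono r" "AE x in M. Cauchy (\<lambda>i. s (r i) x)"
    using cauchy_L1_AE_cauchy_subseq[of M s] s cauchy by auto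
  define Y where "Y x = lim (\<lambda>i. s (r i) x)" for x
  have Ym[measurable]: "Y \<in> borel_measurable M" unfolding Y_def by measurable
  have Y: "AE x in M. (\<lambda>i. s (r i) x) \<longlonglongrightarrow> Y x"
    using r(2) by eventually_elim (simp add: Y_def Cauchy_convergent_iff convergent_LIMSEQ_iff)
  have le: "(\<integral>\<^sup>+x. ennreal \<bar>s n x - Y x\<bar> \<partial>M) \<le> ennreal e"
    if N: "\<And>i j. i \<ge> N \<Longrightarrow> j \<ge> N \<Longrightarrow> (LINT x|M. \<bar>s i x - s j x\<bar>) < e" and n: "n \<ge> N" for N n e
  proof -
    have "(\<integral>\<^sup>+x. ennreal \<bar>s n x - Y x\<bar> \<partial>M) = (\<integral>\<^sup>+x. liminf (\<lambda>i. ennreal \<bar>s n x - s (r i) x\<bar>) \<partial>M)"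
    proof (rule nn_integral_cong_AE, use Y in eventually_elim)
      fix x assume "(\<lambda>i. s (r i) x) \<longlonglongrightarrow> Y x"
      then have "(\<lambda>i. ennreal \<bar>s n x - s (r i) x\<bar>) \<longlonglongrightarrow> ennreal \<bar>s n x - Y x\<bar>"
        by (intro tendsto_intros)
      then show "ennreal \<bar>s n x - Y x\<bar> = liminf (\<lambda>i. ennreal \<bar>s n x - s (r i) x\<bar>)"
        by (rule lim_imp_Liminf[OF sequentially_bot, symmetric])
    qed
    also have "\<dots> \<le> liminf (\<lambda>i. \<integral>\<^sup>+x. ennreal \<bar>s n x - s (r i) x\<bar> \<partial>M)"
      by (rule nn_integral_liminf) measurable
    also have "\<dots> \<le> limsup (\<lambda>i. \<integral>\<^sup>+x. ennreal \<bar>s n x - s (r i) x\<bar> \<partial>M)"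
      by (rule Liminf_le_Limsup) simp
    also have "\<dots> \<le> ennreal e"
    proof (rule Limsup_bounded)
      show "\<forall>\<^sub>F i in sequentially. (\<integral>\<^sup>+x. ennreal \<bar>s n x - s (r i) x\<bar> \<partial>M) \<le> ennreal e"
        using eventually_ge_at_top[of N]
      proof eventually_elim
        case (elim i)
        then have "r i \<ge> N" using seq_suble[OF r(1), of i] by simp
        then have "(LINT x|M. \<bar>s n x - s (r i) x\<bar>) < e" using N n by simp
        then show ?case using s by (subst nn_integral_eq_integral) (auto intro!: ennreal_leI)
      qed
    qed
    finally show ?thesis .
  qed
  have int: "integrable M Y"
  proof -
    obtain N where N: "\<And>i j. i \<ge> N \<Longrightarrow> j \<ge> N \<Longrightarrow> (LINT x|M. \<bar>s i x - s j x\<bar>) < 1"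
      using cauchy[of 1] by auto
    have "(\<integral>\<^sup>+x. ennreal \<bar>s N x - Y x\<bar> \<partial>M) \<le> ennreal 1" by (rule le[OF N]) auto
    then have "integrable M (\<lambda>x. s N x - Y x)"
      by (intro integrableI_bounded) (auto simp: less_top[symmetric] top_unique)
    from Bochner_Integration.integrable_diff[OF s[of N] this] show ?thesis by simp
  qed
  have "(\<lambda>n. LINT x|M. \<bar>s n x - Y x\<bar>) \<longlonglongrightarrow> 0"
  proof (rule LIMSEQ_I)
    fix e :: real assume e: "0 < e"
    then obtain N where N: "\<And>i j. i \<ge> N \<Longrightarrow> j \<ge> N \<Longrightarrow> (LINT x|M. \<bar>s i x - s j x\<bar>) < e / 2"
      using cauchy[of "e/2"] by auto
    show "\<exists>N. \<forall>n\<ge>N. norm ((LINT x|M. \<bar>s n x - Y x\<bar>) - 0) < e"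
    proof (intro exI[of _ N] allI impI)
      fix n assume n: "n \<ge> N"
      have "ennreal (LINT x|M. \<bar>s n x - Y x\<bar>) \<le> ennreal (e / 2)"
        using le[OF N n] s int by (subst nn_integral_eq_integral[symmetric]) auto
      then have "(LINT x|M. \<bar>s n x - Y x\<bar>) \<le> e / 2" using e by simp
      moreover have "0 \<le> (LINT x|M. \<bar>s n x - Y x\<bar>)" by (intro integral_nonneg_AE) auto
      ultimately show "norm ((LINT x|M. \<bar>s n x - Y x\<bar>) - 0) < e" using e by simp
    qed
  qed
  with int show ?thesis by blast
qed

lemma iid_standard_normal:
  defines "M \<equiv> (\<Pi>\<^sub>M k\<in>(UNIV :: nat set). std_normal_distribution)"
  shows "prob_space M"
    and "gaussian_char M (\<Sum>k<n. (a k)\<^sup>2) (\<lambda>\<omega>. \<Sum>k<n. a k * \<omega> k)"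
proof -
  have ps: "prob_space std_normal_distribution"
    by (rule prob_space_normal_density) simp
  show "prob_space M" unfolding M_def by (rule prob_space_PiM) (rule ps)
  interpret P: prob_space M by fact
  have sM: "sets M = sets (\<Pi>\<^sub>M k\<in>(UNIV :: nat set). borel)"
    unfolding M_def by (rule sets_PiM_cong) auto
  have m: "(\<lambda>\<omega>. \<omega> k) \<in> borel_measurable M" for k
    by (subst measurable_cong_sets[OF sM refl]) measurable
  have d: "distr M borel (\<lambda>\<omega>. \<omega> k) = std_normal_distribution" for k
    using distr_PiM_component[of UNIV "\<lambda>_::nat. std_normal_distribution" k] ps
    unfolding M_def by (metis (no_types, lifting) UNIV_I distr_cong sets_density sets_lborel)
  have "P.indep_vars (\<lambda>_. borel) (\<lambda>k \<omega>. \<omega> k) (UNIV :: nat set)"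
  proof (subst P.indep_vars_iff_distr_eq_PiM')
    have "distr M (Pi\<^sub>M UNIV (\<lambda>i. borel)) (\<lambda>x. \<lambda>i\<in>UNIV. x i) = distr M M (\<lambda>x. x)"
      by (rule distr_cong) (auto simp: sM)
    also have "\<dots> = M" by (rule distr_id)
    also have "\<dots> = (\<Pi>\<^sub>M i\<in>UNIV. distr M borel (\<lambda>\<omega>. \<omega> i))" by (simp add: d M_def[symmetric])
    finally show "distr M (Pi\<^sub>M UNIV (\<lambda>i. borel)) (\<lambda>x. \<lambda>i\<in>UNIV. x i) = (\<Pi>\<^sub>M i\<in>UNIV. distr M borel (\<lambda>\<omega>. \<omega> i))" .
  qed (auto simp: m)
  then have "P.indep_vars (\<lambda>_. borel) (\<lambda>k \<omega>. \<omega> k) {..<n}"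
    by (rule P.indep_vars_subset) auto
  then have ind: "P.indep_vars (\<lambda>_. borel) (\<lambda>k \<omega>. a k * \<omega> k) {..<n}"
    by (rule P.indep_vars_compose2) measurable
  show "gaussian_char M (\<Sum>k<n. (a k)\<^sup>2) (\<lambda>\<omega>. \<Sum>k<n. a k * \<omega> k)"
    unfolding gaussian_char_def
  proof (intro conjI allI)
    show mm: "(\<lambda>\<omega>. \<Sum>k<n. a k * \<omega> k) \<in> borel_measurable M"
      using m by measurable
    fix t
    have "(CLINT \<omega>|M. iexp (t * (\<Sum>k<n. a k * \<omega> k))) = char (distr M borel (\<lambda>\<omega>. \<Sum>k<n. a k * \<omega> k)) t"
      by (rule char_eq_integral[OF mm, symmetric])
    also have "\<dots> = (\<Prod>k<n. char (distr M borel (\<lambda>\<omega>. a k * \<omega> k)) t)"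
      by (rule P.char_distr_sum[OF ind])
    also have "\<dots> = (\<Prod>k<n. char (distr M borel (\<lambda>\<omega>. \<omega> k)) (t * a k))"
      using m by (intro prod.cong refl) (simp add: char_eq_integral mult.assoc)
    also have "\<dots> = complex_of_real (\<Prod>k<n. exp (- ((a k)\<^sup>2 * t\<^sup>2) / 2))"
      by (simp add: d char_std_normal_distribution power_mult_distrib mult.commute)
    also have "(\<Prod>k<n. exp (- ((a k)\<^sup>2 * t\<^sup>2) / 2)) = exp (\<Sum>k<n. - ((a k)\<^sup>2 * t\<^sup>2) / 2)"
      by (simp add: exp_sum)
    also have "(\<Sum>k<n. - ((a k)\<^sup>2 * t\<^sup>2) / 2) = - ((\<Sum>k<n. (a k)\<^sup>2) * t\<^sup>2) / 2"
      by (simp add: sum_distrib_right sum_divide_distrib sum_negf)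
    finally show "(CLINT \<omega>|M. iexp (t * (\<Sum>k<n. a k * \<omega> k))) = complex_of_real (exp (- ((\<Sum>k<n. (a k)\<^sup>2) * t\<^sup>2) / 2))" .
  qed
qed

text \<open>
  The Gaussian family \<open>W b = (\<Sum>k. a b k * \<xi> k)\<close> for independent standard normal \<open>\<xi> k\<close>. Convergence
  in mean suffices to define \<open>W\<close>; a finite combination of the \<open>W b\<close> is the limit in mean of
  combinations of finitely many \<open>\<xi> k\<close>, which are normal by independence.
\<close>

lemma gaussian_family_of_square_summable:
  fixes a :: "'b \<Rightarrow> nat \<Rightarrow> real"
  assumes a: "\<And>b c. summable (\<lambda>k. a b k * a c k)"
  obtains M :: "(nat \<Rightarrow> real) measure" and W where
    "prob_space M" "\<And>b. integrable M (W b)"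
    "\<And>T c. finite T \<Longrightarrow> gaussian_char M (\<Sum>b\<in>T. \<Sum>b'\<in>T. c b * c b' * (\<Sum>k. a b k * a b' k))
        (\<lambda>\<omega>. \<Sum>b\<in>T. c b * W b \<omega>)"
proof -
  define M where "M = (\<Pi>\<^sub>M k\<in>(UNIV :: nat set). std_normal_distribution)"
  define S where "S b n \<omega> = (\<Sum>k<n. a b k * \<omega> k)" for b n and \<omega> :: "nat \<Rightarrow> real"
  interpret prob_space M unfolding M_def by (rule iid_standard_normal)
  have g: "gaussian_char M (\<Sum>k<n. (e k)\<^sup>2) (\<lambda>\<omega>. \<Sum>k<n. e k * \<omega> k)" for e n
    unfolding M_def by (rule iid_standard_normal)
  have int: "integrable M (S b n)" for b n
    unfolding S_def by (rule gaussian_char_L1[OF g]) (simp add: sum_nonneg)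
  have bound: "(\<integral>\<omega>. \<bar>S b m \<omega> - S b n \<omega>\<bar> \<partial>M) \<le> sqrt (\<Sum>k\<in>{n..<m}. (a b k)\<^sup>2)" if "n \<le> m" for b m n
  proof -
    define e where "e k = (if n \<le> k then a b k else 0)" for k
    have "S b m \<omega> - S b n \<omega> = (\<Sum>k\<in>{n..<m}. a b k * \<omega> k)" for \<omega>
      unfolding S_def using sum_diff_nat_ivl[of 0 n m "\<lambda>k. a b k * \<omega> k"] that
      by (simp add: lessThan_atLeast0)
    moreover have "(\<Sum>k\<in>{n..<m}. a b k * \<omega> k) = (\<Sum>k<m. e k * \<omega> k)" for \<omega>
      unfolding e_def by (intro sum.mono_neutral_cong_left) auto
    moreover have "(\<Sum>k\<in>{n..<m}. (a b k)\<^sup>2) = (\<Sum>k<m. (e k)\<^sup>2)"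
      unfolding e_def by (intro sum.mono_neutral_cong_left) auto
    ultimately show ?thesis
      using gaussian_char_L1(2)[OF g[of e m]] by (simp add: sum_nonneg)
  qed
  have "\<exists>Y. integrable M Y \<and> (\<lambda>n. \<integral>\<omega>. \<bar>S b n \<omega> - Y \<omega>\<bar> \<partial>M) \<longlonglongrightarrow> 0" for b
  proof (rule L1_complete[OF int])
    fix e :: real assume e: "0 < e"
    obtain N where N: "\<And>m n. m \<ge> N \<Longrightarrow> norm (\<Sum>k\<in>{m..<n}. (a b k)\<^sup>2) < e\<^sup>2"
      using a[of b b] e unfolding summable_Cauchy power2_eq_square by (metis mult_pos_pos)
    have *: "(\<integral>\<omega>. \<bar>S b m \<omega> - S b n \<omega>\<bar> \<partial>M) < e" if "n \<ge> N" "n \<le> m" for m n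
    proof -
      have "sqrt (\<Sum>k\<in>{n..<m}. (a b k)\<^sup>2) < e"
        using N[OF that(1), of m] e by (intro real_less_lsqrt) auto
      with bound[OF that(2)] show ?thesis by (rule order_le_less_trans)
    qed
    show "\<exists>N. \<forall>i\<ge>N. \<forall>j\<ge>N. (\<integral>\<omega>. \<bar>S b i \<omega> - S b j \<omega>\<bar> \<partial>M) < e"
    proof (intro exI[of _ N] allI impI)
      fix i j assume "N \<le> i" "N \<le> j"
      then show "(\<integral>\<omega>. \<bar>S b i \<omega> - S b j \<omega>\<bar> \<partial>M) < e"
        using *[of i j] *[of j i] by (cases "i \<le> j") (auto simp: abs_minus_commute)
    qed
  qed
  then have "\<exists>W. \<forall>b. integrable M (W b) \<and> (\<lambda>n. \<integral>\<omega>. \<bar>S b n \<omega> - W b \<omega>\<bar> \<partial>M) \<longlonglongrightarrow> 0"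
    by (intro choice allI)
  then obtain W where W: "\<And>b. integrable M (W b)"
    and lim: "\<And>b. (\<lambda>n. \<integral>\<omega>. \<bar>S b n \<omega> - W b \<omega>\<bar> \<partial>M) \<longlonglongrightarrow> 0"
    by blast
  show thesis
  proof (rule that)
    show "prob_space M" by unfold_locales
    show "integrable M (W b)" for b by (rule W)
    fix T :: "'b set" and c :: "'b \<Rightarrow> real" assume T: "finite T"
    show "gaussian_char M (\<Sum>b\<in>T. \<Sum>b'\<in>T. c b * c b' * (\<Sum>k. a b k * a b' k)) (\<lambda>\<omega>. \<Sum>b\<in>T. c b * W b \<omega>)"
    proof (rule gaussian_char_L1_limit)
      let ?e = "\<lambda>k. \<Sum>b\<in>T. c b * a b k"
      show "gaussian_char M (\<Sum>k<n. (?e k)\<^sup>2) (\<lambda>\<omega>. \<Sum>b\<in>T. c b * S b n \<omega>)" for n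
      proof -
        have "(\<Sum>b\<in>T. c b * S b n \<omega>) = (\<Sum>k<n. ?e k * \<omega> k)" for \<omega>
          unfolding S_def sum_distrib_left sum_distrib_right
          by (subst sum.swap) (simp add: mult.assoc)
        with g[of ?e n] show ?thesis by simp
      qed
      show "integrable M (\<lambda>\<omega>. \<Sum>b\<in>T. c b * S b n \<omega>)" for n using int by auto
      show "integrable M (\<lambda>\<omega>. \<Sum>b\<in>T. c b * W b \<omega>)" using W by auto
      have "(\<Sum>k<n. (?e k)\<^sup>2) = (\<Sum>b\<in>T. \<Sum>b'\<in>T. c b * c b' * (\<Sum>k<n. a b k * a b' k))" for n
      proof -
        have "(\<Sum>k<n. (?e k)\<^sup>2) = (\<Sum>k<n. \<Sum>b\<in>T. \<Sum>b'\<in>T. c b * c b' * (a b k * a b' k))"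
          by (simp add: power2_eq_square sum_product mult_ac)
        also have "\<dots> = (\<Sum>b\<in>T. \<Sum>b'\<in>T. \<Sum>k<n. c b * c b' * (a b k * a b' k))"
          by (subst sum.swap, rule sum.cong[OF refl], rule sum.swap)
        finally show ?thesis by (simp add: sum_distrib_left)
      qed
      then show "(\<lambda>n. \<Sum>k<n. (?e k)\<^sup>2) \<longlonglongrightarrow> (\<Sum>b\<in>T. \<Sum>b'\<in>T. c b * c b' * (\<Sum>k. a b k * a b' k))"
        using a by (auto intro!: tendsto_intros summable_LIMSEQ)
      show "(\<lambda>n. \<integral>\<omega>. \<bar>(\<Sum>b\<in>T. c b * S b n \<omega>) - (\<Sum>b\<in>T. c b * W b \<omega>)\<bar> \<partial>M) \<longlonglongrightarrow> 0"
      proof (rule tendsto_sandwich[OF _ _ tendsto_const])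
        show "\<forall>\<^sub>F n in sequentially. 0 \<le> (\<integral>\<omega>. \<bar>(\<Sum>b\<in>T. c b * S b n \<omega>) - (\<Sum>b\<in>T. c b * W b \<omega>)\<bar> \<partial>M)"
          by (intro always_eventually allI integral_nonneg_AE) auto
        show "\<forall>\<^sub>F n in sequentially. (\<integral>\<omega>. \<bar>(\<Sum>b\<in>T. c b * S b n \<omega>) - (\<Sum>b\<in>T. c b * W b \<omega>)\<bar> \<partial>M)
            \<le> (\<Sum>b\<in>T. \<bar>c b\<bar> * (\<integral>\<omega>. \<bar>S b n \<omega> - W b \<omega>\<bar> \<partial>M))"
        proof (intro always_eventually allI)
          fix n
          have "(\<integral>\<omega>. \<bar>(\<Sum>b\<in>T. c b * S b n \<omega>) - (\<Sum>b\<in>T. c b * W b \<omega>)\<bar> \<partial>M)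
              \<le> (\<integral>\<omega>. (\<Sum>b\<in>T. \<bar>c b\<bar> * \<bar>S b n \<omega> - W b \<omega>\<bar>) \<partial>M)"
          proof (rule integral_mono)
            fix \<omega>
            have "(\<Sum>b\<in>T. c b * S b n \<omega>) - (\<Sum>b\<in>T. c b * W b \<omega>) = (\<Sum>b\<in>T. c b * (S b n \<omega> - W b \<omega>))"
              by (simp add: sum_subtractf right_diff_distrib)
            then show "\<bar>(\<Sum>b\<in>T. c b * S b n \<omega>) - (\<Sum>b\<in>T. c b * W b \<omega>)\<bar> \<le> (\<Sum>b\<in>T. \<bar>c b\<bar> * \<bar>S b n \<omega> - W b \<omega>\<bar>)"
              using sum_abs[of "\<lambda>b. c b * (S b n \<omega> - W b \<omega>)" T] by (simp add: abs_mult)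
          qed (use int W in auto)
          also have "\<dots> = (\<Sum>b\<in>T. \<bar>c b\<bar> * (\<integral>\<omega>. \<bar>S b n \<omega> - W b \<omega>\<bar> \<partial>M))"
            using int W by (subst Bochner_Integration.integral_sum) auto
          finally show "(\<integral>\<omega>. \<bar>(\<Sum>b\<in>T. c b * S b n \<omega>) - (\<Sum>b\<in>T. c b * W b \<omega>)\<bar> \<partial>M)
            \<le> (\<Sum>b\<in>T. \<bar>c b\<bar> * (\<integral>\<omega>. \<bar>S b n \<omega> - W b \<omega>\<bar> \<partial>M))" .
        qed
        show "(\<lambda>n. \<Sum>b\<in>T. \<bar>c b\<bar> * (\<integral>\<omega>. \<bar>S b n \<omega> - W b \<omega>\<bar> \<partial>M)) \<longlonglongrightarrow> 0"
        proof -
          have "(\<lambda>n. \<Sum>b\<in>T. \<bar>c b\<bar> * (\<integral>\<omega>. \<bar>S b n \<omega> - W b \<omega>\<bar> \<partial>M)) \<longlonglongrightarrow> (\<Sum>b\<in>T. \<bar>c b\<bar> * 0)"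
            by (intro tendsto_intros lim)
          then show ?thesis by simp
        qed
      qed
    qed
  qed
qed


section \<open>Expansion of positive semidefinite kernels\<close>

text \<open>
  Indexing by \<open>{..<n}\<close> instead of by finite sets of points allows repeated points, so that a further
  point can be appended to a family without asking whether it occurs already.
\<close>

definition psd_kernel :: "('b \<Rightarrow> 'b \<Rightarrow> real) \<Rightarrow> bool" where
  "psd_kernel K \<longleftrightarrow> (\<forall>x y. K x y = K y x) \<and>
     (\<forall>(n::nat) x u. 0 \<le> (\<Sum>k<n. \<Sum>l<n. u k * u l * K (x k) (x l)))"

lemma psd_kernelD:
  "psd_kernel K \<Longrightarrow> 0 \<le> (\<Sum>k<(n::nat). \<Sum>l<n. u k * u l * K (x k) (x l))"
  unfolding psd_kernel_def by blast

lemma psd_kernel_quadratic: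
  assumes "psd_kernel K"
  shows "0 \<le> \<alpha>\<^sup>2 * K x x + 2 * \<alpha> * \<beta> * K x y + \<beta>\<^sup>2 * K y y"
proof -
  have "0 \<le> (\<Sum>k<(2::nat). \<Sum>l<(2::nat). (if k = 0 then \<alpha> else \<beta>) * (if l = 0 then \<alpha> else \<beta>) *
      K (if k = 0 then x else y) (if l = (0::nat) then x else y))"
    using psd_kernelD[OF assms, where n = 2 and u = "\<lambda>k. if k = 0 then \<alpha> else \<beta>"
        and x = "\<lambda>k. if k = 0 then x else y"] .
  also have "\<dots> = \<alpha>\<^sup>2 * K x x + 2 * \<alpha> * \<beta> * K x y + \<beta>\<^sup>2 * K y y"
    using assms unfolding psd_kernel_def by (simp add: numeral_2_eq_2 power2_eq_square algebra_simps)
  finally show ?thesis .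
qed

lemma psd_kernel_diag: "psd_kernel K \<Longrightarrow> 0 \<le> K x x"
  using psd_kernel_quadratic[of K 1 x 0 x] by simp

lemma psd_kernel_Cauchy_Schwarz:
  assumes K: "psd_kernel K"
  shows "(K x y)\<^sup>2 \<le> K x x * K y y"
proof (cases "K x x = 0")
  case True
  have "K x y = 0"
  proof (rule ccontr)
    assume n: "K x y \<noteq> 0"
    have "0 \<le> 2 * (- (K y y + 1) / (2 * K x y)) * K x y + K y y"
      using psd_kernel_quadratic[OF K, of "- (K y y + 1) / (2 * K x y)" x 1 y] True by simp
    also have "\<dots> = -1" using n by (simp add: field_simps)
    finally show False by simp
  qed
  then show ?thesis using True by simp
next
  case False
  then have p: "0 < K x x" using psd_kernel_diag[OF K, of x] by simp
  have "0 \<le> (K x y)\<^sup>2 * K x x + 2 * - K x y * K x x * K x y + (K x x)\<^sup>2 * K y y"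
    using psd_kernel_quadratic[OF K, of "- K x y" x "K x x" y] by simp
  also have "\<dots> = K x x * (K x x * K y y - (K x y)\<^sup>2)"
    by (simp add: power2_eq_square algebra_simps)
  finally show ?thesis using p by (simp add: zero_le_mult_iff)
qed

definition pivot :: "('b \<Rightarrow> 'b \<Rightarrow> real) \<Rightarrow> 'b \<Rightarrow> 'b \<Rightarrow> real" where
  "pivot K d x = K x d / sqrt (K d d)"

definition schur :: "('b \<Rightarrow> 'b \<Rightarrow> real) \<Rightarrow> 'b \<Rightarrow> 'b \<Rightarrow> 'b \<Rightarrow> real" where
  "schur K d x y = K x y - pivot K d x * pivot K d y"

text \<open>
  If the pivot \<open>K d d\<close> is 0, then the column of \<open>d\<close> vanishes by Cauchy--Schwarz, so the convention
  \<open>x / 0 = 0\<close> in \<open>pivot\<close> gives the right remainder.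
\<close>

lemma schur_pivot_column:
  assumes K: "psd_kernel K"
  shows "schur K d x d = 0"
proof (cases "K d d = 0")
  case True
  then have "K x d = 0" using psd_kernel_Cauchy_Schwarz[OF K, of x d] by simp
  then show ?thesis by (simp add: schur_def pivot_def)
next
  case False
  then have "0 < K d d" using psd_kernel_diag[OF K, of d] by simp
  then show ?thesis by (simp add: schur_def pivot_def)
qed

text \<open>
  The quadratic form of the Schur complement is the minimum, over the weight given to the
  additional point \<open>d\<close>, of the quadratic form of \<open>K\<close>.
\<close>

lemma psd_kernel_schur:
  assumes K: "psd_kernel K"
  shows "psd_kernel (schur K d)"
  unfolding psd_kernel_def
proof (intro conjI allI)
  have sym: "K x y = K y x" for x y using K by (simp add: psd_kernel_def)
  show "schur K d x y = schur K d y x" for x y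
    by (simp add: schur_def sym[of x y] mult.commute)
  fix n :: nat and x u
  show "0 \<le> (\<Sum>k<n. \<Sum>l<n. u k * u l * schur K d (x k) (x l))"
  proof (cases "K d d = 0")
    case True
    then have "schur K d = K" by (intro ext) (simp add: schur_def pivot_def)
    with K show ?thesis by (simp add: psd_kernel_def)
  next
    case False
    then have p: "0 < K d d" using psd_kernel_diag[OF K, of d] by simp
    define m where "m = (\<Sum>k<n. u k * K (x k) d)"
    \<comment> \<open>the minimising weight at \<open>d\<close>\<close>
    define c where "c = - m / K d d"
    define x' u' where "x' = x(n := d)" and "u' = u(n := c)"
    have "0 \<le> (\<Sum>k<Suc n. \<Sum>l<Suc n. u' k * u' l * K (x' k) (x' l))"
      by (rule psd_kernelD[OF K])
    also have "\<dots> = (\<Sum>k<n. \<Sum>l<n. u k * u l * K (x k) (x l)) + (\<Sum>k<n. u k * c * K (x k) d)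
       + ((\<Sum>l<n. c * u l * K d (x l)) + c * c * K d d)"
      by (simp add: x'_def u'_def sum.distrib)
    also have "(\<Sum>k<n. u k * c * K (x k) d) = c * m"
      by (simp add: m_def sum_distrib_left mult_ac)
    also have "(\<Sum>l<n. c * u l * K d (x l)) = c * m"
      by (simp add: m_def sum_distrib_left mult_ac sym[of d])
    also have "(\<Sum>k<n. \<Sum>l<n. u k * u l * K (x k) (x l)) + c * m + (c * m + c * c * K d d)
       = (\<Sum>k<n. \<Sum>l<n. u k * u l * K (x k) (x l)) - m * m / K d d"
      using p by (simp add: c_def field_simps)
    also have "m * m / K d d = (\<Sum>k<n. \<Sum>l<n. u k * u l * (pivot K d (x k) * pivot K d (x l)))"
    proof -
      have "m * m / K d d = (m / sqrt (K d d)) * (m / sqrt (K d d))" using p by simp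
      also have "m / sqrt (K d d) = (\<Sum>k<n. u k * pivot K d (x k))"
        by (simp add: m_def pivot_def sum_divide_distrib)
      finally show ?thesis by (simp add: sum_product mult_ac)
    qed
    finally show ?thesis
      by (simp add: schur_def right_diff_distrib sum_subtractf)
  qed
qed

primrec schur_iter :: "('b \<Rightarrow> 'b \<Rightarrow> real) \<Rightarrow> (nat \<Rightarrow> 'b) \<Rightarrow> nat \<Rightarrow> 'b \<Rightarrow> 'b \<Rightarrow> real" where
  "schur_iter K d 0 = K"
| "schur_iter K d (Suc n) = schur (schur_iter K d n) (d n)"

text \<open>
  Infinite Cholesky decomposition. After \<open>n\<close> eliminations the remainder \<open>R n\<close> vanishes on
  \<open>d 0, \<dots>, d (n - 1)\<close>, and the squared distance that it defines is bounded by the one of \<open>K\<close>.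
  Hence \<open>R n x x\<close>, the squared distance from \<open>x\<close> to an eliminated point, becomes small.
\<close>

lemma psd_kernel_expansion:
  fixes d :: "nat \<Rightarrow> 'b"
  assumes K: "psd_kernel K"
    and dense: "\<And>x e. 0 < e \<Longrightarrow> \<exists>m. K x x - 2 * K x (d m) + K (d m) (d m) < e"
  obtains a where "\<And>x y. (\<lambda>k. a x k * a y k) sums K x y"
proof -
  define R where "R n = schur_iter K d n" for n
  define a where "a x n = pivot (R n) (d n) x" for x n
  have psd: "psd_kernel (R n)" for n
    unfolding R_def by (induction n) (simp_all add: K psd_kernel_schur)
  have Suc: "R (Suc n) x y = R n x y - a x n * a y n" for n x y
    by (simp add: R_def schur_def a_def)
  have part: "K x y = (\<Sum>k<n. a x k * a y k) + R n x y" for n x y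
    by (induction n) (simp_all add: R_def[of 0] Suc)
  have zero: "R n x (d m) = 0" if "m < n" for m n x
    using that
  proof (induction n arbitrary: x)
    case (Suc n)
    show ?case
    proof (cases "m = n")
      case True
      then show ?thesis using schur_pivot_column[OF psd] by (simp add: R_def)
    next
      case False
      then have "R n y (d m) = 0" for y using Suc by simp
      moreover have "R n (d m) y = R n y (d m)" for y
        using psd[of n] by (simp add: psd_kernel_def)
      ultimately show ?thesis by (simp add: \<open>\<And>y x n. R (Suc n) x y = R n x y - a x n * a y n\<close> a_def pivot_def)
    qed
  qed simp
  have diag: "(\<lambda>n. R n x x) \<longlonglongrightarrow> 0" for x
  proof (rule LIMSEQ_I)
    fix e :: real assume "0 < e"
    then obtain m where m: "K x x - 2 * K x (d m) + K (d m) (d m) < e" using dense by blast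
    show "\<exists>N. \<forall>n\<ge>N. norm (R n x x - 0) < e"
    proof (intro exI[of _ "Suc m"] allI impI)
      fix n assume n: "n \<ge> Suc m"
      have "R n x x = R n x x - 2 * R n x (d m) + R n (d m) (d m)"
        using zero[of m n] n by simp
      also have "\<dots> = (K x x - 2 * K x (d m) + K (d m) (d m)) - (\<Sum>k<n. (a x k - a (d m) k)\<^sup>2)"
        unfolding part[of _ _ n] by (simp add: power2_eq_square algebra_simps sum.distrib sum_subtractf sum_distrib_left)
      also have "\<dots> < e" using m sum_nonneg[of "{..<n}" "\<lambda>k. (a x k - a (d m) k)\<^sup>2"] by simp
      finally show "norm (R n x x - 0) < e" using psd_kernel_diag[OF psd] by simp
    qed
  qed
  have R0: "(\<lambda>n. R n x y) \<longlonglongrightarrow> 0" for x y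
  proof (rule Lim_null_comparison)
    show "\<forall>\<^sub>F n in sequentially. norm (R n x y) \<le> sqrt (R n x x * R n y y)"
      using psd_kernel_Cauchy_Schwarz[OF psd, of _ x y] by (intro always_eventually allI) (simp add: real_le_rsqrt)
    show "(\<lambda>n. sqrt (R n x x * R n y y)) \<longlonglongrightarrow> 0"
      using tendsto_real_sqrt[OF tendsto_mult[OF diag[of x] diag[of y]]] by simp
  qed
  have "(\<lambda>k. a x k * a y k) sums K x y" for x y
  proof -
    have "(\<lambda>n. K x y - R n x y) \<longlonglongrightarrow> K x y - 0" by (intro tendsto_intros R0)
    moreover have "(\<lambda>n. \<Sum>k<n. a x k * a y k) = (\<lambda>n. K x y - R n x y)"
    proof
      show "(\<Sum>k<n. a x k * a y k) = K x y - R n x y" for n using part[of x y n] by linarith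
    qed
    ultimately show ?thesis by (simp add: sums_def)
  qed
  then show thesis by (rule that)
qed


section \<open>Covariance matrix functions and positive semidefinite kernels\<close>

text \<open>
  Existence of the process. The index set is \<open>'n \<times> real\<close>; continuity in mean square makes the
  countable set of rational times dense, and covariances are recovered from the variances of
  \<open>W b + W b'\<close> and \<open>W b - W b'\<close> by polarisation.
\<close>

lemma covariance_matrix_function_of_psd_kernel:
  fixes S :: "real \<Rightarrow> real \<Rightarrow> real ^ 'n::finite ^ 'n"
  assumes K: "psd_kernel (\<lambda>(i, s) (j, t). S s t $ i $ j)"
    and cont: "\<And>i t. ((\<lambda>s. S t t $ i $ i - 2 * S t s $ i $ i + S s s $ i $ i) \<longlongrightarrow> 0) (at t)"
  shows "covariance_matrix_function S"
proof -
  define K where "K = (\<lambda>(i, s) (j, t). S s t $ i $ j)"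
  define D :: "('n \<times> real) set" where "D = UNIV \<times> \<rat>"
  have D: "countable D" "D \<noteq> {}" unfolding D_def by (auto simp: countable_rat uncountable_def countable_finite)
  define d where "d = from_nat_into D"
  have rd: "range d = D" unfolding d_def using D by (intro range_from_nat_into)
  have "\<exists>m. K x x - 2 * K x (d m) + K (d m) (d m) < e" if e: "0 < e" for x e
  proof -
    obtain i t where x: "x = (i, t)" by force
    have "\<forall>\<^sub>F s in at t. S t t $ i $ i - 2 * S t s $ i $ i + S s s $ i $ i < e"
      using order_tendstoD(2)[OF cont e] .
    then obtain \<delta> where \<delta>: "0 < \<delta>" "\<And>s. s \<noteq> t \<Longrightarrow> dist s t < \<delta> \<Longrightarrow> S t t $ i $ i - 2 * S t s $ i $ i + S s s $ i $ i < e"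
      unfolding eventually_at by auto
    obtain q where q: "q \<in> \<rat>" "t < q" "q < t + \<delta>" using Rats_dense_in_real[of t "t + \<delta>"] \<delta> by auto
    then have "(i, q) \<in> range d" unfolding rd D_def by simp
    then obtain m where "d m = (i, q)" by force
    then show ?thesis using \<delta>(2)[of q] q by (intro exI[of _ m]) (auto simp: K_def x dist_real_def)
  qed
  with assms(1) obtain a where a: "\<And>x y. (\<lambda>k. a x k * a y k) sums K x y"
    unfolding K_def[symmetric] by (rule psd_kernel_expansion) auto
  obtain M :: "(nat \<Rightarrow> real) measure" and W where M: "prob_space M" and Wi: "\<And>b. integrable M (W b)"
    and W: "\<And>T c. finite T \<Longrightarrow> gaussian_char M (\<Sum>b\<in>T. \<Sum>b'\<in>T. c b * c b' * (\<Sum>k. a b k * a b' k))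
        (\<lambda>\<omega>. \<Sum>b\<in>T. c b * W b \<omega>)"
    using gaussian_family_of_square_summable[of a, OF sums_summable[OF a]] by blast
  interpret prob_space M by (rule M)
  have W: "gaussian_char M (\<Sum>b\<in>T. \<Sum>b'\<in>T. c b * c b' * K b b') (\<lambda>\<omega>. \<Sum>b\<in>T. c b * W b \<omega>)" if "finite T" for T c
    using W[OF that, of c] a sums_unique[OF a, symmetric] by simp
  have nn: "0 \<le> (\<Sum>b\<in>T. \<Sum>b'\<in>T. c b * c b' * K b b')" if "finite T" for T c
  proof -
    obtain f where f: "bij_betw f {..<card T} T" using ex_bij_betw_nat_finite[OF \<open>finite T\<close>] unfolding lessThan_atLeast0 by blast
    have "(\<Sum>b\<in>T. \<Sum>b'\<in>T. c b * c b' * K b b') = (\<Sum>k<card T. \<Sum>l<card T. c (f k) * c (f l) * K (f k) (f l))"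
      by (simp add: sum.reindex_bij_betw[OF f, symmetric])
    then show ?thesis using assms(1) unfolding psd_kernel_def K_def[symmetric] by simp
  qed
  define X :: "real \<Rightarrow> (nat \<Rightarrow> real) \<Rightarrow> real ^ 'n" where "X t \<omega> = (\<chi> i. W (i, t) \<omega>)" for t \<omega>
  have Wm[measurable]: "W b \<in> borel_measurable M" for b using Wi by auto
  show ?thesis
  proof (rule covariance_matrix_functionI)
    show "centered_gaussian_process M X"
      unfolding centered_gaussian_process_def
    proof (intro conjI allI impI)
      show "prob_space M" by (rule M)
      show "X t \<in> borel_measurable M" for t
      proof (rule borel_measurable_euclidean_space[THEN iffD2], rule ballI)
        fix b :: "real ^ 'n" assume "b \<in> Basis"
        then obtain i where "b = axis i 1" by (auto simp: Basis_vec_def)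
        then show "(\<lambda>x. X t x \<bullet> b) \<in> borel_measurable M" by (simp add: X_def inner_axis)
      qed
      fix T :: "real set" and u :: "real \<Rightarrow> real ^ 'n" assume T: "finite T"
      define c where "c = (\<lambda>(i, t). u t $ i)"
      have "(\<Sum>t\<in>T. u t \<bullet> X t \<omega>) = (\<Sum>b\<in>UNIV \<times> T. c b * W b \<omega>)" for \<omega>
      proof -
        have "(\<Sum>t\<in>T. u t \<bullet> X t \<omega>) = (\<Sum>t\<in>T. \<Sum>i\<in>UNIV. c (i, t) * W (i, t) \<omega>)"
          by (simp add: inner_vec_def X_def c_def)
        also have "\<dots> = (\<Sum>i\<in>UNIV. \<Sum>t\<in>T. c (i, t) * W (i, t) \<omega>)" by (rule sum.swap)
        also have "\<dots> = (\<Sum>b\<in>UNIV \<times> T. c b * W b \<omega>)"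
          by (subst sum.cartesian_product) (simp add: split_beta)
        finally show ?thesis .
      qed
      then show "centered_normal M (\<lambda>\<omega>. \<Sum>t\<in>T. u t \<bullet> X t \<omega>)"
        using gaussian_char_centered_normal[OF W nn, of "UNIV \<times> T" c] T by simp
    qed
    show "has_covariance M X S"
      unfolding has_covariance_def
    proof (intro allI)
      fix i j :: 'n and s t :: real
      define b b' where "b = (i, s)" and "b' = (j, t)"
      have "has_bochner_integral M (\<lambda>\<omega>. W b \<omega> * W b' \<omega>) (K b b')"
      proof (cases "b = b'")
        case True
        show ?thesis
          using gaussian_char_second_moment[OF W nn, of "{b}" "\<lambda>_. 1"] True by (simp add: power2_eq_square)
      next
        case False
        have sym: "K b' b = K b b'" using assms(1) unfolding psd_kernel_def K_def[symmetric] by blast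
        define c where "c \<epsilon> = (\<lambda>x. if x = b then 1 else \<epsilon>)" for \<epsilon> :: real
        have m: "has_bochner_integral M (\<lambda>\<omega>. (W b \<omega> + \<epsilon> * W b' \<omega>)\<^sup>2) (K b b + 2 * \<epsilon> * K b b' + \<epsilon>\<^sup>2 * K b' b')" for \<epsilon>
          using gaussian_char_second_moment[OF W nn, of "{b, b'}" "c \<epsilon>"] False
          by (simp add: c_def sym power2_eq_square algebra_simps)
        have "has_bochner_integral M (\<lambda>\<omega>. ((W b \<omega> + 1 * W b' \<omega>)\<^sup>2 - (W b \<omega> + (-1) * W b' \<omega>)\<^sup>2) / 4)
          (((K b b + 2 * 1 * K b b' + 1\<^sup>2 * K b' b') - (K b b + 2 * (-1) * K b b' + (-1)\<^sup>2 * K b' b')) / 4)"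
          by (intro has_bochner_integral_divide has_bochner_integral_diff m)
        then show ?thesis by (simp add: power2_eq_square algebra_simps)
      qed
      then show "has_bochner_integral M (\<lambda>\<omega>. X s \<omega> $ i * X t \<omega> $ j) (S s t $ i $ j)"
        by (simp add: X_def b_def b'_def K_def)
    qed
  qed
qed

text \<open>
  The quadratic form is the second moment of a linear combination.
\<close>

lemma covariance_matrix_function_quadratic_form:
  fixes S :: "real \<Rightarrow> real \<Rightarrow> real ^ 'n::finite ^ 'n"
  assumes S: "covariance_matrix_function S" and I: "finite I"
  shows "0 \<le> (\<Sum>k\<in>I. \<Sum>l\<in>I. \<Sum>i\<in>UNIV. \<Sum>j\<in>UNIV. u k i * u l j * S (x k) (x l) $ i $ j)"
proof -
  obtain M :: "(real \<Rightarrow> real ^ 'n) measure" and X where c: "has_covariance M X S"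
    using S unfolding covariance_matrix_function_def by blast
  have *: "has_bochner_integral M (\<lambda>\<omega>. \<Sum>k\<in>I. \<Sum>l\<in>I. \<Sum>i\<in>UNIV. \<Sum>j\<in>UNIV. u k i * u l j * (X (x k) \<omega> $ i * X (x l) \<omega> $ j))
     (\<Sum>k\<in>I. \<Sum>l\<in>I. \<Sum>i\<in>UNIV. \<Sum>j\<in>UNIV. u k i * u l j * S (x k) (x l) $ i $ j)"
    using c unfolding has_covariance_def by (auto intro!: has_bochner_integral_sum has_bochner_integral_mult_right)
  have "(\<Sum>k\<in>I. \<Sum>l\<in>I. \<Sum>i\<in>UNIV. \<Sum>j\<in>UNIV. u k i * u l j * (X (x k) \<omega> $ i * X (x l) \<omega> $ j))
     = (\<Sum>k\<in>I. \<Sum>i\<in>UNIV. u k i * X (x k) \<omega> $ i)\<^sup>2" for \<omega>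
    by (simp add: power2_eq_square sum_product mult_ac)
  with * have "has_bochner_integral M (\<lambda>\<omega>. (\<Sum>k\<in>I. \<Sum>i\<in>UNIV. u k i * X (x k) \<omega> $ i)\<^sup>2)
     (\<Sum>k\<in>I. \<Sum>l\<in>I. \<Sum>i\<in>UNIV. \<Sum>j\<in>UNIV. u k i * u l j * S (x k) (x l) $ i $ j)" by simp
  from has_bochner_integral_integral_eq[OF this, symmetric] show ?thesis by simp
qed

section \<open>Integrals over the half line\<close>

text \<open>
  Restricting Lebesgue measure, rather than multiplying integrands by an indicator, makes positivity
  of the integration variable available pointwise.
\<close>

definition half_line :: "real measure" where
  "half_line = restrict_space lborel {0<..}"

lemma space_half_line [simp]: "space half_line = {0<..}"
  by (simp add: half_line_def space_restrict_space)

lemma borel_measurable_half_lineI: "f \<in> borel_measurable borel \<Longrightarrow> f \<in> borel_measurable half_line"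
  unfolding half_line_def by (rule measurable_restrict_space1) simp

lemma ident_measurable_half_line [measurable]: "(\<lambda>x. x) \<in> borel_measurable half_line"
  by (rule borel_measurable_half_lineI) simp

lemma fst_measurable_half_line [measurable]: "fst \<in> borel_measurable (half_line \<Otimes>\<^sub>M half_line)"
  using measurable_compose[OF measurable_fst ident_measurable_half_line] by simp

lemma snd_measurable_half_line [measurable]: "snd \<in> borel_measurable (half_line \<Otimes>\<^sub>M half_line)"
  using measurable_compose[OF measurable_snd ident_measurable_half_line] by simp

lemma sigma_finite_half_line: "sigma_finite_measure half_line"
  unfolding half_line_def
  by (rule sigma_finite_measure_restrict_space) (auto intro: lborel.sigma_finite_measure_axioms)

interpretation half_line: sigma_finite_measure half_line
  by (rule sigma_finite_half_line)

interpretation half_line_pair: pair_sigma_finite half_line half_line ..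

lemma has_bochner_integral_half_line:
  fixes f :: "real \<Rightarrow> real"
  shows "has_bochner_integral half_line f I \<longleftrightarrow> has_bochner_integral lborel (\<lambda>x. indicator {0<..} x * f x) I"
  unfolding half_line_def by (subst has_bochner_integral_restrict_space) auto

lemma set_integrable_half_line:
  fixes f :: "real \<Rightarrow> real"
  shows "integrable half_line f \<longleftrightarrow> set_integrable lborel {0<..} f"
  unfolding half_line_def set_integrable_def by (subst integrable_restrict_space) auto

lemma interval_integral_half_line:
  fixes f :: "real \<Rightarrow> real"
  shows "(LBINT x=0..\<infinity>. f x) = (\<integral>x. f x \<partial>half_line)"
  unfolding half_line_def zero_ereal_def interval_integral_to_infinity_eq set_lebesgue_integral_def
  by (subst integral_restrict_space) auto

lemma half_line_FTC_integrable:
  fixes f F :: "real \<Rightarrow> real"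
  assumes F: "\<And>x. 0 < x \<Longrightarrow> (F has_real_derivative f x) (at x)"
    and f: "\<And>x. 0 < x \<Longrightarrow> isCont f x"
    and int: "integrable half_line f"
    and A: "(F \<longlongrightarrow> A) (at_right 0)" and B: "(F \<longlongrightarrow> B) at_top"
  shows "has_bochner_integral half_line f (B - A)"
proof -
  have "(LBINT x=0..\<infinity>. f x) = B - A"
  proof (rule interval_integral_FTC_integrable)
    show "(F has_vector_derivative f x) (at x)" if "0 < ereal x" for x
      using F that by (simp add: has_real_derivative_iff_has_vector_derivative zero_ereal_def)
    show "isCont f x" if "0 < ereal x" for x using f that by (simp add: zero_ereal_def)
    show "set_integrable lborel (einterval 0 \<infinity>) f"
      using int by (simp add: zero_ereal_def set_integrable_half_line)
    show "((F \<circ> real_of_ereal) \<longlongrightarrow> A) (at_right 0)" using A by (simp add: zero_ereal_def ereal_tendsto_simps1)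
    show "((F \<circ> real_of_ereal) \<longlongrightarrow> B) (at_left \<infinity>)" using B by (simp add: ereal_tendsto_simps1)
  qed simp
  then show ?thesis using int by (simp add: has_bochner_integral_iff interval_integral_half_line)
qed

lemma half_line_FTC_nonneg:
  fixes f F :: "real \<Rightarrow> real"
  assumes F: "\<And>x. 0 < x \<Longrightarrow> (F has_real_derivative f x) (at x)"
    and f: "\<And>x. 0 < x \<Longrightarrow> isCont f x"
    and nn: "\<And>x. 0 < x \<Longrightarrow> 0 \<le> f x"
    and A: "(F \<longlongrightarrow> A) (at_right 0)" and B: "(F \<longlongrightarrow> B) at_top"
  shows "has_bochner_integral half_line f (B - A)"
proof -
  have "set_integrable lborel (einterval 0 \<infinity>) f"
  proof (rule interval_integral_FTC_nonneg)
    show "(F has_real_derivative f x) (at x)" if "0 < ereal x" for x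
      using F that by (simp add: zero_ereal_def)
    show "isCont f x" if "0 < ereal x" for x using f that by (simp add: zero_ereal_def)
    show "AE x in lborel. 0 < ereal x \<longrightarrow> ereal x < \<infinity> \<longrightarrow> 0 \<le> f x"
      using nn by (simp add: zero_ereal_def)
    show "((F \<circ> real_of_ereal) \<longlongrightarrow> A) (at_right 0)" using A by (simp add: zero_ereal_def ereal_tendsto_simps1)
    show "((F \<circ> real_of_ereal) \<longlongrightarrow> B) (at_left \<infinity>)" using B by (simp add: ereal_tendsto_simps1)
  qed simp
  then have "integrable half_line f" by (simp add: zero_ereal_def set_integrable_half_line)
  from half_line_FTC_integrable[OF F f this A B] show ?thesis .
qed

lemma gamma_integral_scaled:
  fixes p y :: real
  assumes p: "0 < p" and y: "0 < y"
  shows "has_bochner_integral half_line (\<lambda>x. x powr (p - 1) * exp (- (y * x))) (Gamma p * y powr (- p))"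
proof -
  let ?f = "\<lambda>x::real. indicator {0<..} x * (x powr (p - 1) * exp (- x))"
  have "ennreal (Gamma p) = (\<integral>\<^sup>+x. ennreal (indicator {0..} x * x powr (p - 1) / exp x) \<partial>lborel)"
    by (rule Gamma_conv_nn_integral_real[OF p])
  also have "\<dots> = (\<integral>\<^sup>+x. ennreal (?f x) \<partial>lborel)"
    by (intro nn_integral_cong) (auto simp: indicator_def exp_minus field_simps)
  finally have "has_bochner_integral lborel ?f (Gamma p)"
    using p by (intro has_bochner_integral_nn_integral) (auto simp: Gamma_real_pos less_imp_le)
  then have "has_bochner_integral lborel (\<lambda>x. ?f (0 + y * x)) (Gamma p /\<^sub>R \<bar>y\<bar>)"
    using y by (subst (asm) lborel_has_bochner_integral_real_affine_iff[of y _ _ 0]) auto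
  then have "has_bochner_integral lborel (\<lambda>x. y powr (1 - p) * ?f (0 + y * x)) (y powr (1 - p) * (Gamma p /\<^sub>R \<bar>y\<bar>))"
    by (rule has_bochner_integral_mult_right)
  also have "y powr (1 - p) * (Gamma p /\<^sub>R \<bar>y\<bar>) = Gamma p * y powr (- p)"
    using y by (simp add: powr_diff powr_minus divide_simps)
  also have "(\<lambda>x. y powr (1 - p) * ?f (0 + y * x)) = (\<lambda>x. indicator {0<..} x * (x powr (p - 1) * exp (- (y * x))))"
  proof
    fix x
    show "y powr (1 - p) * ?f (0 + y * x) = indicator {0<..} x * (x powr (p - 1) * exp (- (y * x)))"
      using y by (cases "0 < x") (auto simp: indicator_def zero_less_mult_iff powr_mult powr_diff field_simps)
  qed
  finally show ?thesis by (simp add: has_bochner_integral_half_line)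
qed

text \<open>
  The substitution \<open>z = y\<^sup>2\<close> in Euler's integral for the Gamma function.
\<close>

lemma gaussian_gamma_integral:
  fixes a w :: real
  assumes a: "0 < a" and w: "0 < w"
  shows "has_bochner_integral half_line (\<lambda>y. y powr (a - 1) * exp (- (w * y\<^sup>2))) (Gamma (a / 2) * w powr (- a / 2) / 2)"
proof -
  let ?f = "\<lambda>z. z powr (a / 2 - 1) * exp (- (w * z))"
  let ?I = "Gamma (a / 2) * w powr (- (a / 2))"
  have img: "(\<lambda>y. y\<^sup>2) ` {0<..} = {0::real<..}"
  proof (intro equalityI subsetI)
    fix z :: real assume "z \<in> {0<..}"
    then show "z \<in> (\<lambda>y. y\<^sup>2) ` {0<..}" by (intro image_eqI[of _ _ "sqrt z"]) auto
  qed auto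
  have hb: "has_bochner_integral half_line ?f ?I" by (rule gamma_integral_scaled) (use a w in auto)
  then have "set_integrable lborel {0<..} ?f" by (simp add: has_bochner_integral_iff set_integrable_half_line)
  then have 1: "?f absolutely_integrable_on {0<..}"
    by (auto simp: set_integrable_def integrable_completion)
  have 2: "integral {0<..} ?f = ?I"
    using set_borel_integral_eq_integral(2)[OF \<open>set_integrable lborel {0<..} ?f\<close>] hb
    unfolding set_lebesgue_integral_def half_line_def
    by (subst (asm) has_bochner_integral_restrict_space) (auto simp: has_bochner_integral_iff)
  have cv: "(\<lambda>y. \<bar>2 * y\<bar> * ?f (y\<^sup>2)) absolutely_integrable_on {0<..} \<and> integral {0<..} (\<lambda>y. \<bar>2 * y\<bar> * ?f (y\<^sup>2)) = ?I"
  proof (rule has_absolute_integral_change_of_variables_1'[where f = ?f and g = "\<lambda>y. y\<^sup>2"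
        and g' = "\<lambda>y. 2 * y" and S = "{0<..}" and b = ?I, THEN iffD2])
    show "((\<lambda>y. y\<^sup>2) has_real_derivative 2 * x) (at x within {0<..})" for x :: real
      by (auto intro!: derivative_eq_intros)
    show "inj_on (\<lambda>y. y\<^sup>2) {0::real<..}" by (auto simp: inj_on_def power2_eq_iff)
  qed (use 1 2 img in auto)
  have "\<bar>2 * y\<bar> * ?f (y\<^sup>2) = 2 * (y powr (a - 1) * exp (- (w * y\<^sup>2)))" if "0 < y" for y
  proof -
    have "(y\<^sup>2) powr (a / 2 - 1) = y powr (a - 2)"
      using that by (simp add: powr_powr flip: powr_numeral)
    then show ?thesis using that by (simp add: powr_diff power2_eq_square)
  qed
  then have eq: "y \<in> {0<..} \<Longrightarrow> \<bar>2 * y\<bar> * ?f (y\<^sup>2) = 2 * (y powr (a - 1) * exp (- (w * y\<^sup>2)))" for y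
    by simp
  have *: "set_integrable lebesgue {0<..} (\<lambda>y. 2 * (y powr (a - 1) * exp (- (w * y\<^sup>2))))"
    using cv by (subst set_integrable_cong[OF refl refl eq[symmetric]]) auto
  have **: "integral {0<..} (\<lambda>y. 2 * (y powr (a - 1) * exp (- (w * y\<^sup>2)))) = ?I"
    using cv by (subst Henstock_Kurzweil_Integration.integral_cong[OF eq[symmetric]]) auto
  have s: "set_integrable lborel {0<..} (\<lambda>y. 2 * (y powr (a - 1) * exp (- (w * y\<^sup>2))))"
    using * unfolding set_integrable_def by (subst (asm) integrable_completion) auto
  have l: "set_lebesgue_integral lborel {0<..} (\<lambda>y. 2 * (y powr (a - 1) * exp (- (w * y\<^sup>2)))) = ?I"
    using set_borel_integral_eq_integral(2)[OF s] ** by (rule trans)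
  have "has_bochner_integral half_line (\<lambda>y. 2 * (y powr (a - 1) * exp (- (w * y\<^sup>2)))) ?I"
    using s l unfolding has_bochner_integral_half_line
    unfolding has_bochner_integral_iff set_lebesgue_integral_def set_integrable_def
    by (simp only: real_scaleR_def)
  from has_bochner_integral_mult_right[OF this, of "1/2"] show ?thesis by simp
qed

lemma Gamma_reflection_real:
  fixes b :: real
  shows "Gamma b * Gamma (1 - b) = pi / sin (pi * b)"
proof -
  have "Gamma (complex_of_real b) * Gamma (complex_of_real (1 - b)) = complex_of_real pi / complex_of_real (sin (pi * b))"
    using Gamma_reflection_complex[of "complex_of_real b"]
    by (simp only: of_real_diff of_real_1 of_real_mult sin_of_real[symmetric])
  then have "complex_of_real (Gamma b * Gamma (1 - b)) = complex_of_real (pi / sin (pi * b))"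
    by (simp only: Gamma_complex_of_real of_real_mult of_real_divide)
  then show ?thesis by (simp only: of_real_eq_iff)
qed

lemma half_line_AE_I: "(\<And>x. 0 < x \<Longrightarrow> P x) \<Longrightarrow> AE x in half_line. P x"
  by (rule AE_I2) simp

lemma nn_integral_half_line:
  assumes "has_bochner_integral half_line f I" "\<And>x. 0 < x \<Longrightarrow> 0 \<le> f x"
  shows "(\<integral>\<^sup>+x. ennreal (f x) \<partial>half_line) = ennreal I"
  using assms by (subst nn_integral_eq_integral) (auto simp: has_bochner_integral_iff intro: half_line_AE_I)

lemma exp_integral:
  fixes y :: real
  assumes "0 < y"
  shows "has_bochner_integral half_line (\<lambda>x. exp (- (y * x))) (1 / y)"
proof -
  have "has_bochner_integral half_line (\<lambda>x. x powr (1 - 1) * exp (- (y * x))) (Gamma 1 * y powr (- 1))"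
    by (rule gamma_integral_scaled) (use assms in auto)
  also have "Gamma 1 * y powr (- 1) = 1 / y" using assms by (simp add: powr_minus field_simps)
  finally show ?thesis
    by (subst has_bochner_integral_cong[of _ half_line _ "\<lambda>x. x powr (1 - 1) * exp (- (y * x))"]) auto
qed

text \<open>
  Writing \<open>1 / (y\<^sup>2 + u\<^sup>2)\<close> as the integral of \<open>exp (- w * (y\<^sup>2 + u\<^sup>2))\<close> over \<open>w\<close> and exchanging the
  integrals gives \<open>Gamma (a / 2) * Gamma (1 - a / 2)\<close>, which the reflection formula evaluates.
\<close>

lemma mellin_rational:
  fixes a u :: real
  assumes a: "0 < a" "a < 2" and u: "u \<noteq> 0"
  shows "has_bochner_integral half_line (\<lambda>y. y powr (a - 1) / (y\<^sup>2 + u\<^sup>2))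
           (\<bar>u\<bar> powr (a - 2) * (pi / 2 / sin (pi * a / 2)))"
proof (rule has_bochner_integral_nn_integral)
  let ?I = "\<bar>u\<bar> powr (a - 2) * (pi / 2 / sin (pi * a / 2))"
  let ?h = "\<lambda>y w. y powr (a - 1) * exp (- (w * (y\<^sup>2 + u\<^sup>2)))"
  have "sin (pi * a / 2) > 0" using a by (intro sin_gt_zero) auto
  then show "0 \<le> ?I" by simp
  show "(\<lambda>y. y powr (a - 1) / (y\<^sup>2 + u\<^sup>2)) \<in> borel_measurable half_line" by measurable
  show "AE y in half_line. 0 \<le> y powr (a - 1) / (y\<^sup>2 + u\<^sup>2)" by simp
  have "(\<integral>\<^sup>+y. ennreal (y powr (a - 1) / (y\<^sup>2 + u\<^sup>2)) \<partial>half_line) = (\<integral>\<^sup>+y. (\<integral>\<^sup>+w. ennreal (?h y w) \<partial>half_line) \<partial>half_line)"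
  proof (rule nn_integral_cong)
    fix y :: real
    assume "y \<in> space half_line"
    then have "has_bochner_integral half_line (\<lambda>w. y powr (a - 1) * exp (- ((y\<^sup>2 + u\<^sup>2) * w))) (y powr (a - 1) * (1 / (y\<^sup>2 + u\<^sup>2)))"
      by (intro has_bochner_integral_mult_right exp_integral) (auto simp: add_pos_nonneg)
    then have "(\<integral>\<^sup>+w. ennreal (y powr (a - 1) * exp (- ((y\<^sup>2 + u\<^sup>2) * w))) \<partial>half_line) = ennreal (y powr (a - 1) * (1 / (y\<^sup>2 + u\<^sup>2)))"
      by (rule nn_integral_half_line) simp
    then show "ennreal (y powr (a - 1) / (y\<^sup>2 + u\<^sup>2)) = (\<integral>\<^sup>+w. ennreal (?h y w) \<partial>half_line)"
      by (simp add: mult.commute)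
  qed
  also have "\<dots> = (\<integral>\<^sup>+w. (\<integral>\<^sup>+y. ennreal (?h y w) \<partial>half_line) \<partial>half_line)"
    by (rule half_line_pair.Fubini'[symmetric]) measurable
  also have "\<dots> = (\<integral>\<^sup>+w. ennreal (Gamma (a / 2) / 2 * (w powr (1 - a / 2 - 1) * exp (- (u\<^sup>2 * w)))) \<partial>half_line)"
  proof (rule nn_integral_cong)
    fix w :: real
    assume "w \<in> space half_line"
    then have w: "0 < w" by simp
    have "(\<integral>\<^sup>+y. ennreal (exp (- (u\<^sup>2 * w)) * (y powr (a - 1) * exp (- (w * y\<^sup>2)))) \<partial>half_line)
       = ennreal (exp (- (u\<^sup>2 * w)) * (Gamma (a / 2) * w powr (- a / 2) / 2))"
      by (intro nn_integral_half_line has_bochner_integral_mult_right gaussian_gamma_integral) (use a w in auto)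
    then show "(\<integral>\<^sup>+y. ennreal (?h y w) \<partial>half_line) = ennreal (Gamma (a / 2) / 2 * (w powr (1 - a / 2 - 1) * exp (- (u\<^sup>2 * w))))"
      by (simp add: algebra_simps exp_add exp_diff exp_minus divide_simps)
  qed
  also have "\<dots> = ennreal (Gamma (a / 2) / 2 * (Gamma (1 - a / 2) * (u\<^sup>2) powr (- (1 - a / 2))))"
    by (intro nn_integral_half_line has_bochner_integral_mult_right gamma_integral_scaled)
       (use a u in \<open>auto intro!: Gamma_real_nonneg\<close>)
  also have "Gamma (a / 2) / 2 * (Gamma (1 - a / 2) * (u\<^sup>2) powr (- (1 - a / 2))) = ?I"
  proof -
    have "(u\<^sup>2) powr (- (1 - a / 2)) = \<bar>u\<bar> powr (a - 2)"
    proof -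
      have "u\<^sup>2 = \<bar>u\<bar> powr 2" using u by (simp add: powr_numeral)
      then have "(u\<^sup>2) powr (- (1 - a / 2)) = \<bar>u\<bar> powr (2 * - (1 - a / 2))" by (simp only: powr_powr)
      also have "2 * - (1 - a / 2) = a - 2" by simp
      finally show ?thesis .
    qed
    then have "Gamma (a / 2) / 2 * (Gamma (1 - a / 2) * (u\<^sup>2) powr (- (1 - a / 2)))
        = \<bar>u\<bar> powr (a - 2) * ((Gamma (a / 2) * Gamma (1 - a / 2)) / 2)" by (simp only: mult_ac times_divide_eq_left times_divide_eq_right)
    also have "\<dots> = ?I" unfolding Gamma_reflection_real by simp
    finally show ?thesis .
  qed
  finally show "(\<integral>\<^sup>+y. ennreal (y powr (a - 1) / (y\<^sup>2 + u\<^sup>2)) \<partial>half_line) = ennreal ?I" .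
qed

text \<open>
  This replaces \<open>mellin_rational\<close> at the exponent \<open>a = 2\<close>, where the integral of
  \<open>y / (y\<^sup>2 + u\<^sup>2)\<close> diverges logarithmically. The difference has an elementary primitive and constant
  sign, so the fundamental theorem of calculus also yields its integrability.
\<close>

lemma log_regularised_integral:
  fixes u :: real
  assumes u: "u \<noteq> 0"
  shows "has_bochner_integral half_line (\<lambda>y. y * (1 / (y\<^sup>2 + u\<^sup>2) - 1 / (y\<^sup>2 + 1))) (- ln \<bar>u\<bar>)"
proof -
  let ?f = "\<lambda>y. y * (1 / (y\<^sup>2 + u\<^sup>2) - 1 / (y\<^sup>2 + 1))"
  let ?F = "\<lambda>y. (ln (y\<^sup>2 + u\<^sup>2) - ln (y\<^sup>2 + 1)) / 2"
  have pos: "0 < y\<^sup>2 + u\<^sup>2" for y :: real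
    using u by (simp only: sum_power2_gt_zero_iff) simp
  have pos1: "0 < y\<^sup>2 + 1" for y :: real
    by (rule add_nonneg_pos) simp_all
  have nz: "y\<^sup>2 + u\<^sup>2 \<noteq> 0" "y\<^sup>2 + 1 \<noteq> 0" for y :: real
    by (rule less_imp_neq[THEN not_sym], rule pos, rule less_imp_neq[THEN not_sym], rule pos1)
  have F: "(?F has_real_derivative ?f y) (at y)" for y
  proof -
    have "(?F has_real_derivative (2 * y / (y\<^sup>2 + u\<^sup>2) - 2 * y / (y\<^sup>2 + 1)) / 2) (at y)"
      using pos[of y] pos1[of y] by (auto intro!: derivative_eq_intros)
    moreover have "(2 * y / A - 2 * y / B) / 2 = y * (1 / A - 1 / B)" for A B :: real
      by (simp add: diff_divide_distrib right_diff_distrib)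
    ultimately show ?thesis by metis
  qed
  have c: "isCont ?f y" for y using nz[of y] by (intro continuous_intros) auto
  have "(?F \<longlongrightarrow> (ln (0\<^sup>2 + u\<^sup>2) - ln (0\<^sup>2 + 1)) / 2) (at_right 0)"
    using nz by (intro tendsto_intros) auto
  then have A: "(?F \<longlongrightarrow> ln \<bar>u\<bar>) (at_right 0)" using u ln_realpow[of "\<bar>u\<bar>" 2] by simp
  have B: "(?F \<longlongrightarrow> 0) at_top" by real_asymp
  have fac: "?f y = y * (1 - u\<^sup>2) / ((y\<^sup>2 + u\<^sup>2) * (y\<^sup>2 + 1))" for y
    using nz[of y] by (simp add: field_simps)
  show ?thesis
  proof (cases "u\<^sup>2 \<le> 1")
    case True
    have "has_bochner_integral half_line ?f (0 - ln \<bar>u\<bar>)"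
    proof (rule half_line_FTC_nonneg[OF F c _ A B])
      show "0 \<le> ?f y" if "0 < y" for y unfolding fac using True that by (intro divide_nonneg_nonneg mult_nonneg_nonneg) auto
    qed
    then show ?thesis by simp
  next
    case False
    have "has_bochner_integral half_line (\<lambda>y. - ?f y) (- 0 - (- ln \<bar>u\<bar>))"
    proof (rule half_line_FTC_nonneg[OF DERIV_minus[OF F] _ _ tendsto_minus[OF A] tendsto_minus[OF B]])
      show "isCont (\<lambda>y. - ?f y) y" for y by (intro continuous_intros c)
      show "0 \<le> - ?f y" if "0 < y" for y
        unfolding fac minus_divide_left minus_mult_right using False that by (intro divide_nonneg_nonneg mult_nonneg_nonneg) auto
    qed
    from has_bochner_integral_minus[OF this] show ?thesis by simp
  qed
qed

text \<open>
  The constants \<open>a\<close>, \<open>b\<close> parametrise the primitive, so the integrand is what its derivative turns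
  out to be; sine and cosine are obtained by solving two linear equations for \<open>a\<close> and \<open>b\<close>.
\<close>

lemma laplace_trig:
  fixes a b u y :: real
  assumes y: "0 < y"
  shows "has_bochner_integral half_line
     (\<lambda>x. exp (- (y * x)) * ((- y * a - u * b) * sin (u * x) + (u * a - y * b) * cos (u * x))) (- b)"
proof -
  let ?F = "\<lambda>x. exp (- (y * x)) * (a * sin (u * x) + b * cos (u * x))"
  let ?f = "\<lambda>x. exp (- (y * x)) * ((- y * a - u * b) * sin (u * x) + (u * a - y * b) * cos (u * x))"
  have bound: "\<bar>p * sin (u * x) + q * cos (u * x)\<bar> \<le> \<bar>p\<bar> + \<bar>q\<bar>" for p q x :: real
    by (rule order_trans[OF abs_triangle_ineq add_mono]) (auto simp: abs_mult intro!: mult_left_le)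
  have "has_bochner_integral half_line ?f (0 - ?F 0)"
  proof (rule half_line_FTC_integrable)
    show "(?F has_real_derivative ?f x) (at x)" for x
      by (auto intro!: derivative_eq_intros simp: algebra_simps)
    show "isCont ?f x" for x by (intro continuous_intros)
    show "integrable half_line ?f"
    proof (rule Bochner_Integration.integrable_bound)
      show "integrable half_line (\<lambda>x. exp (- (y * x)) * (\<bar>- y * a - u * b\<bar> + \<bar>u * a - y * b\<bar>))"
        using exp_integral[OF y] by (simp add: has_bochner_integral_iff)
      show "AE x in half_line. norm (?f x) \<le> norm (exp (- (y * x)) * (\<bar>- y * a - u * b\<bar> + \<bar>u * a - y * b\<bar>))"
        unfolding real_norm_def abs_mult
        by (intro half_line_AE_I mult_left_mono order_trans[OF bound abs_ge_self]) simp
    qed measurable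
    show "(?F \<longlongrightarrow> ?F 0) (at_right 0)" by (intro tendsto_intros)
    show "(?F \<longlongrightarrow> 0) at_top"
    proof (rule Lim_null_comparison)
      show "\<forall>\<^sub>F x in at_top. norm (?F x) \<le> exp (- (y * x)) * (\<bar>a\<bar> + \<bar>b\<bar>)"
        using bound[of a _ b] by (intro always_eventually allI) (simp add: abs_mult)
      have "((\<lambda>x. exp (- (y * x))) \<longlongrightarrow> 0) at_top" using y by real_asymp
      then show "((\<lambda>x. exp (- (y * x)) * (\<bar>a\<bar> + \<bar>b\<bar>)) \<longlongrightarrow> 0) at_top" by (rule tendsto_mult_left_zero)
    qed
  qed
  then show ?thesis by simp
qed

lemma laplace_sin_cos:
  fixes u y :: real
  assumes y: "0 < y"
  shows laplace_sin: "has_bochner_integral half_line (\<lambda>x. exp (- (y * x)) * sin (u * x)) (u / (y\<^sup>2 + u\<^sup>2))"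
    and laplace_cos: "has_bochner_integral half_line (\<lambda>x. exp (- (y * x)) * cos (u * x)) (y / (y\<^sup>2 + u\<^sup>2))"
proof -
  define D where "D = y\<^sup>2 + u\<^sup>2"
  have D: "D \<noteq> 0" using y by (simp add: D_def sum_power2_eq_zero_iff)
  have "- y * (- y / D) - u * (- u / D) = 1" "u * (u / D) - y * (- y / D) = 1"
    using D by (simp_all add: D_def power2_eq_square flip: add_divide_distrib)
  moreover have "u * (- y / D) - y * (- u / D) = 0" "- y * (u / D) - u * (- y / D) = 0" by simp_all
  ultimately show "has_bochner_integral half_line (\<lambda>x. exp (- (y * x)) * sin (u * x)) (u / (y\<^sup>2 + u\<^sup>2))"
      "has_bochner_integral half_line (\<lambda>x. exp (- (y * x)) * cos (u * x)) (y / (y\<^sup>2 + u\<^sup>2))"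
    using laplace_trig[OF y, of "- y / D" u "- u / D"] laplace_trig[OF y, of "u / D" u "- y / D"]
    unfolding D_def[symmetric] by (simp_all only: mult_1_left mult_zero_left add_0_left add_0_right minus_divide_left minus_minus)
qed


section \<open>Laplace transforms and power weights\<close>

lemma Gamma_weight_integral:
  fixes h x :: real
  assumes "-1 < h" "0 < x"
  shows "has_bochner_integral half_line (\<lambda>y. y powr h * exp (- (x * y))) (Gamma (h + 1) * x powr (- h - 1))"
proof -
  have "has_bochner_integral half_line (\<lambda>y. y powr (h + 1 - 1) * exp (- (x * y))) (Gamma (h + 1) * x powr (- (h + 1)))"
    by (rule gamma_integral_scaled) (use assms in auto)
  then show ?thesis by simp
qed

text \<open>
  For a nonnegative \<open>k\<close> with Laplace transform \<open>\<kappa>\<close>, Tonelli's theorem also provides integrability on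
  the side of \<open>x\<close>.
\<close>

lemma laplace_swap_nonneg:
  fixes k \<kappa> :: "real \<Rightarrow> real"
  assumes h: "-1 < h" and k: "k \<in> borel_measurable borel" "\<And>x. 0 < x \<Longrightarrow> 0 \<le> k x"
    and \<kappa>: "\<And>y. 0 < y \<Longrightarrow> has_bochner_integral half_line (\<lambda>x. exp (- (y * x)) * k x) (\<kappa> y)"
    and I: "has_bochner_integral half_line (\<lambda>y. y powr h * \<kappa> y) I"
  shows "has_bochner_integral half_line (\<lambda>x. k x * x powr (- h - 1)) (I / Gamma (h + 1))"
proof -
  have k'[measurable]: "k \<in> borel_measurable half_line" by (rule borel_measurable_half_lineI[OF k(1)])
  have G: "0 < Gamma (h + 1)" using h by (intro Gamma_real_pos) auto
  have \<kappa>0: "0 \<le> \<kappa> y" if "0 < y" for y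
    using has_bochner_integral_integral_eq[OF \<kappa>[OF that], symmetric] k(2)
    by (auto intro!: Bochner_Integration.integral_nonneg_AE half_line_AE_I)
  have I0: "0 \<le> I"
    using has_bochner_integral_integral_eq[OF I, symmetric] \<kappa>0
    by (auto intro!: Bochner_Integration.integral_nonneg_AE half_line_AE_I)
  have "has_bochner_integral half_line (\<lambda>x. k x * (Gamma (h + 1) * x powr (- h - 1))) I"
  proof (rule has_bochner_integral_nn_integral)
    show "(\<lambda>x. k x * (Gamma (h + 1) * x powr (- h - 1))) \<in> borel_measurable half_line" by measurable
    show "AE x in half_line. 0 \<le> k x * (Gamma (h + 1) * x powr (- h - 1))"
      using k(2) G by (intro half_line_AE_I) simp
    have "(\<integral>\<^sup>+x. ennreal (k x * (Gamma (h + 1) * x powr (- h - 1))) \<partial>half_line)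
        = (\<integral>\<^sup>+x. (\<integral>\<^sup>+y. ennreal (k x * (y powr h * exp (- (x * y)))) \<partial>half_line) \<partial>half_line)"
      using k(2) by (intro nn_integral_cong nn_integral_half_line[symmetric] has_bochner_integral_mult_right Gamma_weight_integral) (auto simp: h)
    also have "\<dots> = (\<integral>\<^sup>+y. (\<integral>\<^sup>+x. ennreal (k x * (y powr h * exp (- (x * y)))) \<partial>half_line) \<partial>half_line)"
      by (rule half_line_pair.Fubini'[symmetric]) measurable
    also have "\<dots> = (\<integral>\<^sup>+y. ennreal (y powr h * \<kappa> y) \<partial>half_line)"
    proof (rule nn_integral_cong)
      fix y :: real assume "y \<in> space half_line"
      then have y: "0 < y" by simp
      have "(\<integral>\<^sup>+x. ennreal (y powr h * (exp (- (y * x)) * k x)) \<partial>half_line) = ennreal (y powr h * \<kappa> y)"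
        using k(2) by (intro nn_integral_half_line has_bochner_integral_mult_right \<kappa> y) auto
      then show "(\<integral>\<^sup>+x. ennreal (k x * (y powr h * exp (- (x * y)))) \<partial>half_line) = ennreal (y powr h * \<kappa> y)"
        by (simp add: mult_ac)
    qed
    also have "\<dots> = ennreal I"
      using \<kappa>0 by (intro nn_integral_half_line I) auto
    finally show "(\<integral>\<^sup>+x. ennreal (k x * (Gamma (h + 1) * x powr (- h - 1))) \<partial>half_line) = ennreal I" .
  qed (rule I0)
  from has_bochner_integral_divide[OF this, of "Gamma (h + 1)"] G show ?thesis
    by (simp add: mult_ac)
qed

text \<open>
  The signed version, where integrability on the side of \<open>x\<close> has to be known in advance.
\<close>

lemma laplace_swap:
  fixes k \<kappa> :: "real \<Rightarrow> real"
  assumes h: "-1 < h" and k: "k \<in> borel_measurable borel"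
    and int: "integrable half_line (\<lambda>x. k x * x powr (- h - 1))"
    and \<kappa>: "\<And>y. 0 < y \<Longrightarrow> has_bochner_integral half_line (\<lambda>x. exp (- (y * x)) * k x) (\<kappa> y)"
    and I: "has_bochner_integral half_line (\<lambda>y. y powr h * \<kappa> y) I"
  shows "has_bochner_integral half_line (\<lambda>x. k x * x powr (- h - 1)) (I / Gamma (h + 1))"
proof -
  have k'[measurable]: "k \<in> borel_measurable half_line" by (rule borel_measurable_half_lineI[OF k(1)])
  have G: "0 < Gamma (h + 1)" using h by (intro Gamma_real_pos) auto
  let ?f = "\<lambda>(x, y). k x * (y powr h * exp (- (x * y)))"
  have in0: "(\<integral>y. y powr h * exp (- (x * y)) \<partial>half_line) = Gamma (h + 1) * x powr (- h - 1)" if "0 < x" for x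
    using Gamma_weight_integral[OF h that] by (rule has_bochner_integral_integral_eq)
  have F: "integrable (half_line \<Otimes>\<^sub>M half_line) ?f"
  proof (rule half_line_pair.Fubini_integrable)
    show "?f \<in> borel_measurable (half_line \<Otimes>\<^sub>M half_line)" by measurable
    have "integrable half_line (\<lambda>x. Gamma (h + 1) * norm (k x * x powr (- h - 1)))"
      using int by (intro Bochner_Integration.integrable_mult_right integrable_norm)
    then show "integrable half_line (\<lambda>x. \<integral>y. norm (?f (x, y)) \<partial>half_line)"
      by (rule Bochner_Integration.integrable_cong[THEN iffD1, rotated -1]) (auto simp: in0 abs_mult)
    show "AE x in half_line. integrable half_line (\<lambda>y. ?f (x, y))"
      using Gamma_weight_integral[OF h] by (intro half_line_AE_I) (simp add: has_bochner_integral_iff)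
  qed
  have "(\<integral>x. (\<integral>y. k x * (y powr h * exp (- (x * y))) \<partial>half_line) \<partial>half_line)
      = (\<integral>y. (\<integral>x. k x * (y powr h * exp (- (x * y))) \<partial>half_line) \<partial>half_line)"
    using half_line_pair.Fubini_integral[OF F] by simp
  also have "(\<integral>x. (\<integral>y. k x * (y powr h * exp (- (x * y))) \<partial>half_line) \<partial>half_line)
      = (\<integral>x. Gamma (h + 1) * (k x * x powr (- h - 1)) \<partial>half_line)"
    by (intro Bochner_Integration.integral_cong refl) (simp add: in0)
  also have "(\<integral>y. (\<integral>x. k x * (y powr h * exp (- (x * y))) \<partial>half_line) \<partial>half_line) = (\<integral>y. y powr h * \<kappa> y \<partial>half_line)"
  proof (intro Bochner_Integration.integral_cong refl)
    fix y :: real assume "y \<in> space half_line"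
    then have y: "0 < y" by simp
    have "(\<integral>x. y powr h * (exp (- (y * x)) * k x) \<partial>half_line) = y powr h * \<kappa> y"
      by (rule has_bochner_integral_integral_eq) (intro has_bochner_integral_mult_right \<kappa> y)
    then show "(\<integral>x. k x * (y powr h * exp (- (x * y))) \<partial>half_line) = y powr h * \<kappa> y" by (simp add: mult_ac)
  qed
  also have "\<dots> = I" using I by (rule has_bochner_integral_integral_eq)
  finally have "Gamma (h + 1) * (\<integral>x. k x * x powr (- h - 1) \<partial>half_line) = I" by simp
  with int G show ?thesis by (simp add: has_bochner_integral_iff field_simps)
qed

lemma cos_power_integral:
  fixes h u :: real
  assumes h: "0 < h" "h < 2"
  shows "has_bochner_integral half_line (\<lambda>x. (1 - cos (u * x)) * x powr (- h - 1))
     (\<bar>u\<bar> powr h * (pi / 2) / (Gamma (h + 1) * sin (pi * h / 2)))"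
proof (cases "u = 0")
  case True
  then show ?thesis by (simp add: has_bochner_integral_zero)
next
  case False
  have "has_bochner_integral half_line (\<lambda>x. (1 - cos (u * x)) * x powr (- h - 1))
     (u\<^sup>2 * (\<bar>u\<bar> powr (h - 2) * (pi / 2 / sin (pi * h / 2))) / Gamma (h + 1))"
  proof (rule laplace_swap_nonneg)
    show "has_bochner_integral half_line (\<lambda>x. exp (- (y * x)) * (1 - cos (u * x))) (1 / y - y / (y\<^sup>2 + u\<^sup>2))" if "0 < y" for y
      using has_bochner_integral_diff[OF exp_integral[OF that] laplace_cos[OF that, of u]] by (simp add: right_diff_distrib)
    have "has_bochner_integral half_line (\<lambda>y. u\<^sup>2 * (y powr (h - 1) / (y\<^sup>2 + u\<^sup>2))) (u\<^sup>2 * (\<bar>u\<bar> powr (h - 2) * (pi / 2 / sin (pi * h / 2))))"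
      by (intro has_bochner_integral_mult_right mellin_rational h False)
    moreover have "u\<^sup>2 * (y powr (h - 1) / (y\<^sup>2 + u\<^sup>2)) = y powr h * (1 / y - y / (y\<^sup>2 + u\<^sup>2))" if "0 < y" for y
    proof -
      have nz: "y\<^sup>2 + u\<^sup>2 \<noteq> 0" using that by (simp add: sum_power2_eq_zero_iff)
      have "1 / y - y / (y\<^sup>2 + u\<^sup>2) = u\<^sup>2 / (y * (y\<^sup>2 + u\<^sup>2))"
        using that nz by (simp add: field_simps power2_eq_square)
      then show ?thesis using that by (simp add: powr_diff)
    qed
    ultimately show "has_bochner_integral half_line (\<lambda>y. y powr h * (1 / y - y / (y\<^sup>2 + u\<^sup>2))) (u\<^sup>2 * (\<bar>u\<bar> powr (h - 2) * (pi / 2 / sin (pi * h / 2))))"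
      by (subst has_bochner_integral_cong[where M = half_line and N = half_line and g = "\<lambda>y. u\<^sup>2 * (y powr (h - 1) / (y\<^sup>2 + u\<^sup>2))"]) auto
  qed (use h in auto)
  also have "u\<^sup>2 * (\<bar>u\<bar> powr (h - 2) * (pi / 2 / sin (pi * h / 2))) / Gamma (h + 1) = \<bar>u\<bar> powr h * (pi / 2) / (Gamma (h + 1) * sin (pi * h / 2))"
    using False by (simp add: powr_diff)
  finally show ?thesis .
qed

text \<open>
  The Laplace transform \<open>u / (y\<^sup>2 + u\<^sup>2)\<close> of \<open>sin (u * x)\<close> is integrable against \<open>y powr h\<close> only for
  \<open>h < 1\<close>. For \<open>h > 1\<close> its behaviour \<open>u / y\<^sup>2\<close> at infinity is subtracted. The correction is linear in \<open>u\<close>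
  and therefore cancels in the combination of sines used below.
\<close>

lemma regularised_sin_transform:
  fixes h :: real
  assumes h: "0 < h" "h < 2" "h \<noteq> 1"
  obtains r where "\<And>u. has_bochner_integral half_line (\<lambda>y. y powr h * (u / (y\<^sup>2 + u\<^sup>2) - u * r y))
      (sgn u * \<bar>u\<bar> powr h * (pi / 2 / cos (pi * h / 2)))"
proof (cases "h < 1")
  case True
  show thesis
  proof (rule that[of "\<lambda>_. 0"])
    fix u :: real
    show "has_bochner_integral half_line (\<lambda>y. y powr h * (u / (y\<^sup>2 + u\<^sup>2) - u * 0)) (sgn u * \<bar>u\<bar> powr h * (pi / 2 / cos (pi * h / 2)))"
    proof (cases "u = 0")
      case False
      have "has_bochner_integral half_line (\<lambda>y. u * (y powr (h + 1 - 1) / (y\<^sup>2 + u\<^sup>2)))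
          (u * (\<bar>u\<bar> powr (h + 1 - 2) * (pi / 2 / sin (pi * (h + 1) / 2))))"
        by (intro has_bochner_integral_mult_right mellin_rational False) (use h True in auto)
      also have "sin (pi * (h + 1) / 2) = cos (pi * h / 2)"
        using sin_cos_eq[of "pi * (h + 1) / 2"] cos_minus[of "pi * h / 2"] by (simp add: field_simps)
      also have "u * (\<bar>u\<bar> powr (h + 1 - 2) * (pi / 2 / cos (pi * h / 2))) = sgn u * \<bar>u\<bar> powr h * (pi / 2 / cos (pi * h / 2))"
        using False by (simp add: powr_diff sgn_if)
      finally show ?thesis by (simp add: mult_ac)
    qed (simp add: has_bochner_integral_zero)
  qed
next
  case False
  with h have h1: "1 < h" by simp
  show thesis
  proof (rule that[of "\<lambda>y. 1 / y\<^sup>2"])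
    fix u :: real
    show "has_bochner_integral half_line (\<lambda>y. y powr h * (u / (y\<^sup>2 + u\<^sup>2) - u * (1 / y\<^sup>2))) (sgn u * \<bar>u\<bar> powr h * (pi / 2 / cos (pi * h / 2)))"
    proof (cases "u = 0")
      case nz: False
      have "has_bochner_integral half_line (\<lambda>y. - (u ^ 3) * (y powr (h - 1 - 1) / (y\<^sup>2 + u\<^sup>2)))
          (- (u ^ 3) * (\<bar>u\<bar> powr (h - 1 - 2) * (pi / 2 / sin (pi * (h - 1) / 2))))"
        by (intro has_bochner_integral_mult_right mellin_rational nz) (use h h1 in auto)
      also have "sin (pi * (h - 1) / 2) = - cos (pi * h / 2)"
        using sin_diff[of "pi * h / 2" "pi / 2"] by (simp add: right_diff_distrib diff_divide_distrib)
      also have "- (u ^ 3) * (\<bar>u\<bar> powr (h - 1 - 2) * (pi / 2 / - cos (pi * h / 2))) = sgn u * \<bar>u\<bar> powr h * (pi / 2 / cos (pi * h / 2))"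
        using nz by (simp add: powr_diff sgn_if power2_eq_square power3_eq_cube)
      finally have "has_bochner_integral half_line (\<lambda>y. - (u ^ 3) * (y powr (h - 1 - 1) / (y\<^sup>2 + u\<^sup>2)))
          (sgn u * \<bar>u\<bar> powr h * (pi / 2 / cos (pi * h / 2)))" .
      moreover have "- (u ^ 3) * (y powr (h - 1 - 1) / (y\<^sup>2 + u\<^sup>2)) = y powr h * (u / (y\<^sup>2 + u\<^sup>2) - u * (1 / y\<^sup>2))" if "0 < y" for y
      proof -
        have n: "y\<^sup>2 + u\<^sup>2 \<noteq> 0" using that by (simp add: sum_power2_eq_zero_iff)
        have "u / (y\<^sup>2 + u\<^sup>2) - u * (1 / y\<^sup>2) = - (u ^ 3) / (y\<^sup>2 * (y\<^sup>2 + u\<^sup>2))"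
          using that n by (simp add: divide_simps) (simp add: algebra_simps power2_eq_square power3_eq_cube)
        then show ?thesis using that by (simp add: powr_diff power2_eq_square)
      qed
      ultimately show ?thesis
        by (subst has_bochner_integral_cong[where M = half_line and N = half_line
              and g = "\<lambda>y. - (u ^ 3) * (y powr (h - 1 - 1) / (y\<^sup>2 + u\<^sup>2))"]) auto
    qed (simp add: has_bochner_integral_zero)
  qed
qed

text \<open>
  At \<open>h = 1\<close> an integrand without correction is of order \<open>u / y\<close> at infinity, and one with the
  correction \<open>u / y\<^sup>2\<close> is of that order at 0; the correction \<open>u / (y\<^sup>2 + 1)\<close> avoids both.
\<close>

lemma regularised_sin_transform_1:
  fixes u :: real
  shows "has_bochner_integral half_line (\<lambda>y. y powr 1 * (u / (y\<^sup>2 + u\<^sup>2) - u * (1 / (y\<^sup>2 + 1)))) (- u * ln \<bar>u\<bar>)"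
proof (cases "u = 0")
  case False
  have "has_bochner_integral half_line (\<lambda>y. u * (y * (1 / (y\<^sup>2 + u\<^sup>2) - 1 / (y\<^sup>2 + 1)))) (u * - ln \<bar>u\<bar>)"
    by (intro has_bochner_integral_mult_right log_regularised_integral False)
  then show ?thesis
    by (subst has_bochner_integral_cong[where M = half_line and N = half_line
              and g = "\<lambda>y. u * (y * (1 / (y\<^sup>2 + u\<^sup>2) - 1 / (y\<^sup>2 + 1)))"]) (auto simp: algebra_simps)
qed (simp add: has_bochner_integral_zero)


section \<open>The kernel of the spectral representation\<close>

lemma norm_one_minus_iexp: "(norm (1 - iexp a))\<^sup>2 = 2 * (1 - cos a)"
proof -
  have "(norm (1 - iexp a))\<^sup>2 = (1 - cos a)\<^sup>2 + (sin a)\<^sup>2"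
    by (simp add: cmod_def Re_exp Im_exp)
  also have "\<dots> = 2 * (1 - cos a)"
    using sin_cos_squared_add[of a] by (simp add: power2_eq_square algebra_simps)
  finally show ?thesis .
qed

lemma Re_kernel: "Re (cnj (1 - iexp a) * (1 - iexp b)) = (1 - cos a) + (1 - cos b) - (1 - cos (b - a))"
  by (simp add: Re_exp Im_exp cos_diff algebra_simps)

lemma Im_kernel: "Im (cnj (1 - iexp a) * (1 - iexp b)) = sin a - sin b + sin (b - a)"
  by (simp add: Re_exp Im_exp sin_diff algebra_simps)

lemma kernel_measurable [measurable]:
  "(\<lambda>x. cnj (1 - iexp (s * x)) * (1 - iexp (t * x))) \<in> borel_measurable borel"
  by (intro borel_measurable_continuous_onI continuous_intros)

text \<open>
  By the inequality of arithmetic and geometric means the product is dominated by two terms of the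
  form \<open>1 - cos\<close>, whose integrals are known to be finite.
\<close>

lemma integrable_kernel_power:
  fixes h s t :: real
  assumes h: "0 < h" "h < 2"
  shows "integrable half_line (\<lambda>x. norm (cnj (1 - iexp (s * x)) * (1 - iexp (t * x))) * x powr (- h - 1))"
proof (rule Bochner_Integration.integrable_bound)
  show "integrable half_line (\<lambda>x. (1 - cos (s * x)) * x powr (- h - 1) + (1 - cos (t * x)) * x powr (- h - 1))"
    using cos_power_integral[OF h] by (intro Bochner_Integration.integrable_add) (auto simp: has_bochner_integral_iff)
  show "AE x in half_line. norm (norm (cnj (1 - iexp (s * x)) * (1 - iexp (t * x))) * x powr (- h - 1))
     \<le> norm ((1 - cos (s * x)) * x powr (- h - 1) + (1 - cos (t * x)) * x powr (- h - 1))"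
  proof (rule half_line_AE_I)
    fix x :: real assume "0 < x"
    have "norm (cnj (1 - iexp (s * x)) * (1 - iexp (t * x))) = norm (1 - iexp (s * x)) * norm (1 - iexp (t * x))"
      by (simp only: norm_mult complex_mod_cnj)
    also have "\<dots> \<le> ((norm (1 - iexp (s * x)))\<^sup>2 + (norm (1 - iexp (t * x)))\<^sup>2) / 2"
      using sum_squares_bound[of "norm (1 - iexp (s * x))" "norm (1 - iexp (t * x))"] by (simp del: of_real_mult)
    also have "\<dots> = (1 - cos (s * x)) + (1 - cos (t * x))" unfolding norm_one_minus_iexp by simp
    finally have *: "norm (cnj (1 - iexp (s * x)) * (1 - iexp (t * x))) \<le> (1 - cos (s * x)) + (1 - cos (t * x))" .
    have "norm (norm (cnj (1 - iexp (s * x)) * (1 - iexp (t * x))) * x powr (- h - 1))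
        = norm (cnj (1 - iexp (s * x)) * (1 - iexp (t * x))) * x powr (- h - 1)"
      by (simp only: real_norm_def abs_mult abs_norm_cancel) simp
    also have "\<dots> \<le> ((1 - cos (s * x)) + (1 - cos (t * x))) * x powr (- h - 1)"
      by (rule mult_right_mono[OF *]) simp
    also have "\<dots> \<le> norm ((1 - cos (s * x)) * x powr (- h - 1) + (1 - cos (t * x)) * x powr (- h - 1))"
      unfolding real_norm_def distrib_right by (rule abs_ge_self)
    finally show "norm (norm (cnj (1 - iexp (s * x)) * (1 - iexp (t * x))) * x powr (- h - 1))
     \<le> norm ((1 - cos (s * x)) * x powr (- h - 1) + (1 - cos (t * x)) * x powr (- h - 1))" .
  qed
  have "(\<lambda>x. norm (cnj (1 - iexp (s * x)) * (1 - iexp (t * x))) * x powr (- h - 1)) \<in> borel_measurable borel"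
    by measurable
  then show "(\<lambda>x. norm (cnj (1 - iexp (s * x)) * (1 - iexp (t * x))) * x powr (- h - 1)) \<in> borel_measurable half_line"
    by (rule borel_measurable_half_lineI)
qed

lemma Re_kernel_integral:
  fixes h s t :: real
  assumes h: "0 < h" "h < 2"
  shows "has_bochner_integral half_line (\<lambda>x. Re (cnj (1 - iexp (s * x)) * (1 - iexp (t * x))) * x powr (- h - 1))
     ((\<bar>s\<bar> powr h + \<bar>t\<bar> powr h - \<bar>t - s\<bar> powr h) * ((pi / 2) / (Gamma (h + 1) * sin (pi * h / 2))))"
proof -
  have "has_bochner_integral half_line (\<lambda>x. (1 - cos (s * x)) * x powr (- h - 1) + (1 - cos (t * x)) * x powr (- h - 1)
      - (1 - cos ((t - s) * x)) * x powr (- h - 1))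
     (\<bar>s\<bar> powr h * (pi / 2) / (Gamma (h + 1) * sin (pi * h / 2)) + \<bar>t\<bar> powr h * (pi / 2) / (Gamma (h + 1) * sin (pi * h / 2))
      - \<bar>t - s\<bar> powr h * (pi / 2) / (Gamma (h + 1) * sin (pi * h / 2)))"
    by (intro has_bochner_integral_add has_bochner_integral_diff cos_power_integral h)
  then show ?thesis
    unfolding Re_kernel by (simp add: algebra_simps add_divide_distrib diff_divide_distrib)
qed

text \<open>
  The frequencies \<open>s\<close>, \<open>- t\<close>, \<open>t - s\<close> add up to 0, so the linear corrections \<open>u * r y\<close> disappear from
  the sum of the three transforms.
\<close>

lemma Im_kernel_integral:
  fixes h s t :: real and w r :: "real \<Rightarrow> real"
  assumes h: "0 < h" "h < 2"
    and w: "\<And>u. has_bochner_integral half_line (\<lambda>y. y powr h * (u / (y\<^sup>2 + u\<^sup>2) - u * r y)) (w u)"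
  shows "has_bochner_integral half_line (\<lambda>x. Im (cnj (1 - iexp (s * x)) * (1 - iexp (t * x))) * x powr (- h - 1))
     ((w s - w t + w (t - s)) / Gamma (h + 1))"
proof (rule laplace_swap)
  let ?k = "\<lambda>x. Im (cnj (1 - iexp (s * x)) * (1 - iexp (t * x)))"
  show m: "?k \<in> borel_measurable borel" by measurable
  show "integrable half_line (\<lambda>x. ?k x * x powr (- h - 1))"
  proof (rule Bochner_Integration.integrable_bound[OF integrable_kernel_power[OF h, of s t]])
    have [measurable]: "?k \<in> borel_measurable half_line" using m by (rule borel_measurable_half_lineI)
    show "(\<lambda>x. ?k x * x powr (- h - 1)) \<in> borel_measurable half_line" by measurable
    show "AE x in half_line. norm (?k x * x powr (- h - 1))
        \<le> norm (norm (cnj (1 - iexp (s * x)) * (1 - iexp (t * x))) * x powr (- h - 1))"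
    proof (rule half_line_AE_I)
      fix x :: real
      show "norm (?k x * x powr (- h - 1)) \<le> norm (norm (cnj (1 - iexp (s * x)) * (1 - iexp (t * x))) * x powr (- h - 1))"
        unfolding real_norm_def abs_mult abs_norm_cancel by (intro mult_right_mono abs_Im_le_cmod) simp
    qed
  qed
  show "has_bochner_integral half_line (\<lambda>x. exp (- (y * x)) * ?k x)
     (s / (y\<^sup>2 + s\<^sup>2) - t / (y\<^sup>2 + t\<^sup>2) + (t - s) / (y\<^sup>2 + (t - s)\<^sup>2))" if "0 < y" for y
  proof -
    have "has_bochner_integral half_line (\<lambda>x. exp (- (y * x)) * sin (s * x) - exp (- (y * x)) * sin (t * x) + exp (- (y * x)) * sin ((t - s) * x))
      (s / (y\<^sup>2 + s\<^sup>2) - t / (y\<^sup>2 + t\<^sup>2) + (t - s) / (y\<^sup>2 + (t - s)\<^sup>2))"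
      by (intro has_bochner_integral_add has_bochner_integral_diff laplace_sin that)
    then show ?thesis unfolding Im_kernel by (simp add: algebra_simps)
  qed
  have "has_bochner_integral half_line (\<lambda>y. y powr h * (s / (y\<^sup>2 + s\<^sup>2) - s * r y) - y powr h * (t / (y\<^sup>2 + t\<^sup>2) - t * r y)
     + y powr h * ((t - s) / (y\<^sup>2 + (t - s)\<^sup>2) - (t - s) * r y)) (w s - w t + w (t - s))"
    by (intro has_bochner_integral_add has_bochner_integral_diff w)
  also have "(\<lambda>y. y powr h * (s / (y\<^sup>2 + s\<^sup>2) - s * r y) - y powr h * (t / (y\<^sup>2 + t\<^sup>2) - t * r y)
     + y powr h * ((t - s) / (y\<^sup>2 + (t - s)\<^sup>2) - (t - s) * r y))
     = (\<lambda>y. y powr h * (s / (y\<^sup>2 + s\<^sup>2) - t / (y\<^sup>2 + t\<^sup>2) + (t - s) / (y\<^sup>2 + (t - s)\<^sup>2)))"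
  proof
    fix y
    have "p * (a - s * q) - p * (b - t * q) + p * (c - (t - s) * q) = p * (a - b + c)" for p a b c q :: real
      by (simp add: algebra_simps)
    then show "y powr h * (s / (y\<^sup>2 + s\<^sup>2) - s * r y) - y powr h * (t / (y\<^sup>2 + t\<^sup>2) - t * r y)
     + y powr h * ((t - s) / (y\<^sup>2 + (t - s)\<^sup>2) - (t - s) * r y)
     = y powr h * (s / (y\<^sup>2 + s\<^sup>2) - t / (y\<^sup>2 + t\<^sup>2) + (t - s) / (y\<^sup>2 + (t - s)\<^sup>2))" .
  qed
  finally show "has_bochner_integral half_line (\<lambda>y. y powr h * (s / (y\<^sup>2 + s\<^sup>2) - t / (y\<^sup>2 + t\<^sup>2) + (t - s) / (y\<^sup>2 + (t - s)\<^sup>2)))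
    (w s - w t + w (t - s))" .
qed (use h in auto)

section \<open>The spectral representation\<close>

locale mfbm_parameters =
  fixes H \<sigma> :: "'n::finite \<Rightarrow> real"
    and \<rho> \<eta> \<rho>' \<eta>' :: "'n \<Rightarrow> 'n \<Rightarrow> real"
  assumes H: "\<And>i. 0 < H i \<and> H i < 1"
    and sigma: "\<And>i. 0 < \<sigma> i"
    and rho: "\<And>i j. H i + H j \<noteq> 1 \<Longrightarrow> \<rho> j i = \<rho> i j"
    and eta: "\<And>i j. H i + H j \<noteq> 1 \<Longrightarrow> \<eta> j i = - \<eta> i j"
    and rho': "\<And>i j. H i + H j = 1 \<Longrightarrow> \<rho>' j i = \<rho>' i j"
    and eta': "\<And>i j. H i + H j = 1 \<Longrightarrow> \<eta>' j i = - \<eta>' i j"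
    and diag: "\<And>i. 2 * H i \<noteq> 1 \<Longrightarrow> \<rho> i i = 1 \<and> \<eta> i i = 0"
    and diag': "\<And>i. 2 * H i = 1 \<Longrightarrow> \<rho>' i i = 1 \<and> \<eta>' i i = 0"
begin

abbreviation Q :: "complex ^ 'n ^ 'n" where "Q \<equiv> mfbm_Q H \<rho> \<eta> \<rho>' \<eta>'"
abbreviation S :: "real \<Rightarrow> real \<Rightarrow> real ^ 'n ^ 'n" where "S \<equiv> mfbm_cov H \<sigma> \<rho> \<eta> \<rho>' \<eta>'"

lemma exponent_bounds: "0 < H i + H j" "H i + H j < 2"
  using H[of i] H[of j] by auto

lemma Q_hermitian: "hermitian Q"
  unfolding hermitian_def
proof (intro allI)
  fix i j
  show "Q $ j $ i = cnj (Q $ i $ j)"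
  proof (cases "H i + H j = 1")
    case True
    then show ?thesis using rho'[OF True] eta'[OF True]
      by (simp add: mfbm_Q_def mfbm_tau_def add.commute)
  next
    case False
    then show ?thesis using rho[OF False] eta[OF False]
      by (simp add: mfbm_Q_def mfbm_tau_def add.commute[of "H j" "H i"])
  qed
qed

lemma S_symmetric: "S t s $ j $ i = S s t $ i $ j"
proof (cases "i = j")
  case True
  then show ?thesis by (simp add: mfbm_cov_def abs_minus_commute)
next
  case ij: False
  have sg: "sgn (s - t) = - sgn (t - s)" by (simp add: sgn_if)
  show ?thesis
  proof (cases "H i + H j = 1")
    case True
    then show ?thesis using ij rho'[OF True] eta'[OF True]
      by (simp add: mfbm_cov_def add.commute abs_minus_commute algebra_simps)
  next
    case False
    then have "H j + H i \<noteq> 1" by (simp add: add.commute)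
    then show ?thesis using ij False rho[OF False] eta[OF False] sg
      by (simp add: mfbm_cov_def add.commute[of "H j" "H i"] abs_minus_commute[of s t] algebra_simps)
  qed
qed

text \<open>
  The normalisations of the diagonal parameters make the diagonal entries a special case of the
  formula for the other ones. The three terms are grouped to match the real and the imaginary part of
  the kernel.
\<close>

lemma S_general:
  "S s t $ i $ j = \<sigma> i * \<sigma> j / 2 *
     (if H i + H j \<noteq> 1 then
        \<rho> i j * (\<bar>s\<bar> powr (H i + H j) + \<bar>t\<bar> powr (H i + H j) - \<bar>t - s\<bar> powr (H i + H j))
        + \<eta> i j * (sgn s * \<bar>s\<bar> powr (H i + H j) - sgn t * \<bar>t\<bar> powr (H i + H j) + sgn (t - s) * \<bar>t - s\<bar> powr (H i + H j))
      else
        \<rho>' i j * (\<bar>s\<bar> + \<bar>t\<bar> - \<bar>t - s\<bar>) + \<eta>' i j * (- s * ln \<bar>s\<bar> - - t * ln \<bar>t\<bar> + - (t - s) * ln \<bar>t - s\<bar>))"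
proof (cases "i = j")
  case ij: True
  show ?thesis
  proof (cases "2 * H i = 1")
    case True
    then show ?thesis using ij diag'[OF True] by (simp add: mfbm_cov_def power2_eq_square)
  next
    case False
    then show ?thesis using ij diag[OF False] by (simp add: mfbm_cov_def power2_eq_square)
  qed
next
  case ij: False
  show ?thesis
  proof (cases "H i + H j = 1")
    case True
    then show ?thesis using ij by (simp add: mfbm_cov_def abs_minus_commute[of s t] algebra_simps)
  next
    case False
    then show ?thesis using ij by (simp add: mfbm_cov_def algebra_simps)
  qed
qed

lemma spectral_representation:
  "has_bochner_integral half_line
     (\<lambda>x. Re (cnj (1 - iexp (s * x)) * Q $ i $ j * (1 - iexp (t * x))) * x powr (- (H i + H j) - 1))
     (pi / (\<sigma> i * \<sigma> j) * S s t $ i $ j)"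
proof -
  define h where "h = H i + H j"
  have h: "0 < h" "h < 2" using exponent_bounds[of i j] by (auto simp: h_def)
  have G: "Gamma (h + 1) \<noteq> 0" 
    by (rule less_imp_neq[THEN not_sym], rule Gamma_real_pos) (use h in auto)
  have sn: "sin (pi * h / 2) \<noteq> 0" 
    by (rule less_imp_neq[THEN not_sym], rule sin_gt_zero) (use h in auto)
  have \<sigma>: "\<sigma> i \<noteq> 0" "\<sigma> j \<noteq> 0" using sigma[of i] sigma[of j] by auto
  let ?z = "\<lambda>x. cnj (1 - iexp (s * x)) * (1 - iexp (t * x))"
  let ?R = "(\<bar>s\<bar> powr h + \<bar>t\<bar> powr h - \<bar>t - s\<bar> powr h) * ((pi / 2) / (Gamma (h + 1) * sin (pi * h / 2)))"
  have z: "Re (cnj (1 - iexp (s * x)) * Q $ i $ j * (1 - iexp (t * x))) = Re (Q $ i $ j) * Re (?z x) - Im (Q $ i $ j) * Im (?z x)" for x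
    by (simp add: algebra_simps)
  have comb: "has_bochner_integral half_line
     (\<lambda>x. Re (cnj (1 - iexp (s * x)) * Q $ i $ j * (1 - iexp (t * x))) * x powr (- h - 1))
     (Re (Q $ i $ j) * ?R - Im (Q $ i $ j) * J)"
    if J: "has_bochner_integral half_line (\<lambda>x. Im (?z x) * x powr (- h - 1)) J" for J
  proof -
    have "has_bochner_integral half_line
     (\<lambda>x. Re (Q $ i $ j) * (Re (?z x) * x powr (- h - 1)) - Im (Q $ i $ j) * (Im (?z x) * x powr (- h - 1)))
     (Re (Q $ i $ j) * ?R - Im (Q $ i $ j) * J)"
      by (intro has_bochner_integral_diff has_bochner_integral_mult_right Re_kernel_integral J h)
    then show ?thesis unfolding z by (simp only: left_diff_distrib mult.assoc)
  qed
  show ?thesis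
  proof (cases "h = 1")
    case True
    have "has_bochner_integral half_line (\<lambda>x. Im (?z x) * x powr (- 1 - 1))
       ((- s * ln \<bar>s\<bar> - - t * ln \<bar>t\<bar> + - (t - s) * ln \<bar>t - s\<bar>) / Gamma (1 + 1))"
      by (rule Im_kernel_integral[OF _ _ regularised_sin_transform_1]) auto
    note c = comb[unfolded True, OF this]
    have q: "Re (Q $ i $ j) = \<rho>' i j" "Im (Q $ i $ j) = - (pi / 2 * \<eta>' i j)"
      using True by (simp_all add: mfbm_Q_def mfbm_tau_def h_def Gamma_numeral)
    have "pi / (\<sigma> i * \<sigma> j) * S s t $ i $ j = \<rho>' i j * (\<bar>s\<bar> + \<bar>t\<bar> - \<bar>t - s\<bar>) * (pi / 2)
        + (pi / 2 * \<eta>' i j) * (- s * ln \<bar>s\<bar> - - t * ln \<bar>t\<bar> + - (t - s) * ln \<bar>t - s\<bar>)"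
      using True \<sigma> unfolding S_general h_def by (simp add: field_simps)
    also have "\<dots> = Re (Q $ i $ j) * ((\<bar>s\<bar> powr 1 + \<bar>t\<bar> powr 1 - \<bar>t - s\<bar> powr 1) * ((pi / 2) / (Gamma (1 + 1) * sin (pi * 1 / 2))))
        - Im (Q $ i $ j) * ((- s * ln \<bar>s\<bar> - - t * ln \<bar>t\<bar> + - (t - s) * ln \<bar>t - s\<bar>) / Gamma (1 + 1))"
      unfolding q by (simp add: Gamma_numeral)
    finally show ?thesis using c unfolding h_def[symmetric] True by (simp only:)
  next
    case False
    obtain r where r: "\<And>u. has_bochner_integral half_line (\<lambda>y. y powr h * (u / (y\<^sup>2 + u\<^sup>2) - u * r y))
      (sgn u * \<bar>u\<bar> powr h * (pi / 2 / cos (pi * h / 2)))"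
      by (rule regularised_sin_transform[OF h False]) blast
    note c = comb[OF Im_kernel_integral[OF h r]]
    have cs: "cos (pi * h / 2) \<noteq> 0"
    proof (cases "h < 1")
      case True
      then show ?thesis using h cos_gt_zero[of "pi * h / 2"] by simp
    next
      case F: False
      then have "0 < cos (pi - pi * h / 2)"
        using h False by (intro cos_gt_zero_pi) (auto simp: field_simps)
      then show ?thesis by simp
    qed
    have q: "Re (Q $ i $ j) = Gamma (h + 1) * \<rho> i j * sin (pi * h / 2)" "Im (Q $ i $ j) = - (Gamma (h + 1) * \<eta> i j * cos (pi * h / 2))"
      using False by (simp_all add: mfbm_Q_def mfbm_tau_def h_def)
    have "pi / (\<sigma> i * \<sigma> j) * S s t $ i $ j = \<rho> i j * (\<bar>s\<bar> powr h + \<bar>t\<bar> powr h - \<bar>t - s\<bar> powr h) * (pi / 2)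
        + \<eta> i j * (sgn s * \<bar>s\<bar> powr h - sgn t * \<bar>t\<bar> powr h + sgn (t - s) * \<bar>t - s\<bar> powr h) * (pi / 2)"
    proof -
      have "p / (a * b) * (a * b / 2 * (r * X + e * Y)) = r * X * (p / 2) + e * Y * (p / 2)"
        if "a \<noteq> 0" "b \<noteq> 0" for a b p r e X Y :: real
        using that by (simp add: field_simps)
      from this[OF \<sigma>] False show ?thesis unfolding S_general h_def[symmetric] by (simp only: if_True not_False_eq_True)
    qed
    also have "\<dots> = Re (Q $ i $ j) * ?R - Im (Q $ i $ j) *
        ((sgn s * \<bar>s\<bar> powr h * (pi / 2 / cos (pi * h / 2)) - sgn t * \<bar>t\<bar> powr h * (pi / 2 / cos (pi * h / 2))
          + sgn (t - s) * \<bar>t - s\<bar> powr h * (pi / 2 / cos (pi * h / 2))) / Gamma (h + 1))"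
    proof -
      have "\<rho> i j * X * p + \<eta> i j * (a - b + d) * p
          = g * \<rho> i j * y * (X * (p / (g * y))) - - (g * \<eta> i j * z) * ((a * (p / z) - b * (p / z) + d * (p / z)) / g)"
        if "g \<noteq> 0" "y \<noteq> 0" "z \<noteq> 0" for X p a b d g y z :: real
        using that by (simp add: field_simps)
      from this[OF G sn cs] show ?thesis unfolding q .
    qed
    finally show ?thesis using c unfolding h_def[symmetric] by (simp only:)
  qed
qed

lemma increment_continuous: "((\<lambda>s. S t t $ i $ i - 2 * S t s $ i $ i + S s s $ i $ i) \<longlongrightarrow> 0) (at t)"
proof -
  have "((\<lambda>s. (\<sigma> i)\<^sup>2 * \<bar>s - t\<bar> powr (2 * H i)) \<longlongrightarrow> (\<sigma> i)\<^sup>2 * 0) (at t)"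
  proof (intro tendsto_mult_left tendsto_zero_powrI)
    have "((\<lambda>s. \<bar>s - t\<bar>) \<longlongrightarrow> \<bar>t - t\<bar>) (at t)" by (intro tendsto_intros)
    then show "((\<lambda>s. \<bar>s - t\<bar>) \<longlongrightarrow> 0) (at t)" by simp
    show "((\<lambda>s. 2 * H i) \<longlongrightarrow> 2 * H i) (at t)" by simp
  qed (use H[of i] in auto)
  moreover have "S t t $ i $ i - 2 * S t s $ i $ i + S s s $ i $ i = (\<sigma> i)\<^sup>2 * \<bar>s - t\<bar> powr (2 * H i)" for s
    by (simp add: mfbm_cov_def algebra_simps)
  ultimately show ?thesis by simp
qed

end


section \<open>Sufficiency\<close>

text \<open>
  Repeated indices are harmless: the entries of \<open>V\<close> that belong to the same index are added up.
\<close>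

lemma positive_semidefinite_family:
  fixes A :: "complex ^ 'n::finite ^ 'n" and \<iota> :: "nat \<Rightarrow> 'n" and V :: "nat \<Rightarrow> complex"
  assumes A: "positive_semidefinite A"
  shows "0 \<le> Re (\<Sum>k<n. \<Sum>l<n. cnj (V k) * A $ \<iota> k $ \<iota> l * V l)"
proof -
  define v :: "complex ^ 'n" where "v = (\<chi> i. \<Sum>k<n. if \<iota> k = i then V k else 0)"
  have row: "(\<Sum>j\<in>UNIV. b j * v $ j) = (\<Sum>l<n. b (\<iota> l) * V l)" for b :: "'n \<Rightarrow> complex"
  proof -
    have "(\<Sum>j\<in>UNIV. b j * v $ j) = (\<Sum>j\<in>UNIV. \<Sum>l<n. if \<iota> l = j then b j * V l else 0)"
      unfolding v_def by (simp add: sum_distrib_left if_distrib cong: if_cong)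
    also have "\<dots> = (\<Sum>l<n. \<Sum>j\<in>UNIV. if \<iota> l = j then b j * V l else 0)" by (rule sum.swap)
    finally show ?thesis by simp
  qed
  have col: "(\<Sum>i\<in>UNIV. cnj (v $ i) * b i) = (\<Sum>k<n. cnj (V k) * b (\<iota> k))" for b :: "'n \<Rightarrow> complex"
  proof -
    have "(\<Sum>i\<in>UNIV. cnj (v $ i) * b i) = cnj (\<Sum>i\<in>UNIV. cnj (b i) * v $ i)" by (simp add: mult.commute)
    also have "\<dots> = (\<Sum>k<n. cnj (V k) * b (\<iota> k))" unfolding row by (simp add: mult.commute)
    finally show ?thesis .
  qed
  have "(\<Sum>i\<in>UNIV. \<Sum>j\<in>UNIV. cnj (v $ i) * A $ i $ j * v $ j) = (\<Sum>i\<in>UNIV. cnj (v $ i) * (\<Sum>l<n. A $ i $ \<iota> l * V l))"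
    by (simp only: mult.assoc sum_distrib_left[symmetric] row)
  also have "\<dots> = (\<Sum>k<n. \<Sum>l<n. cnj (V k) * A $ \<iota> k $ \<iota> l * V l)"
    unfolding col by (simp only: sum_distrib_left mult.assoc)
  finally have "(\<Sum>k<n. \<Sum>l<n. cnj (V k) * A $ \<iota> k $ \<iota> l * V l) = (\<Sum>i\<in>UNIV. \<Sum>j\<in>UNIV. cnj (v $ i) * A $ i $ j * v $ j)"
    by (rule sym)
  then show ?thesis using A unfolding positive_semidefinite_def by (simp only:)
qed

context mfbm_parameters
begin

lemma covariance_if_positive_semidefinite:
  assumes Q: "positive_semidefinite Q"
  shows "covariance_matrix_function S"
proof (rule covariance_matrix_function_of_psd_kernel)
  show "psd_kernel (\<lambda>(i, s) (j, t). S s t $ i $ j)"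
    unfolding psd_kernel_def
  proof (intro conjI allI)
    show "(case x of (i, s) \<Rightarrow> \<lambda>(j, t). S s t $ i $ j) y = (case y of (i, s) \<Rightarrow> \<lambda>(j, t). S s t $ i $ j) x" for x y
      by (simp add: split_beta S_symmetric)
    fix n :: nat and x :: "nat \<Rightarrow> 'n \<times> real" and u :: "nat \<Rightarrow> real"
    define \<iota> t where "\<iota> k = fst (x k)" and "t k = snd (x k)" for k
    define c where "c k = u k * \<sigma> (\<iota> k)" for k
    let ?f = "\<lambda>k l z. Re (cnj (1 - iexp (t k * z)) * Q $ \<iota> k $ \<iota> l * (1 - iexp (t l * z))) * z powr (- (H (\<iota> k) + H (\<iota> l)) - 1)"
    have "has_bochner_integral half_line (\<lambda>z. \<Sum>k<n. \<Sum>l<n. (c k * c l / pi) * ?f k l z)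
        (\<Sum>k<n. \<Sum>l<n. (c k * c l / pi) * (pi / (\<sigma> (\<iota> k) * \<sigma> (\<iota> l)) * S (t k) (t l) $ \<iota> k $ \<iota> l))"
      by (intro has_bochner_integral_sum has_bochner_integral_mult_right spectral_representation)
    also have "(\<Sum>k<n. \<Sum>l<n. (c k * c l / pi) * (pi / (\<sigma> (\<iota> k) * \<sigma> (\<iota> l)) * S (t k) (t l) $ \<iota> k $ \<iota> l))
       = (\<Sum>k<n. \<Sum>l<n. u k * u l * S (t k) (t l) $ \<iota> k $ \<iota> l)"
      by (intro sum.cong refl) (simp add: c_def less_imp_neq[OF sigma, THEN not_sym])
    finally have I: "has_bochner_integral half_line (\<lambda>z. \<Sum>k<n. \<Sum>l<n. (c k * c l / pi) * ?f k l z)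
        (\<Sum>k<n. \<Sum>l<n. u k * u l * S (t k) (t l) $ \<iota> k $ \<iota> l)" .
    have re: "Re (complex_of_real r * w) = r * Re w" for r w by simp
    have "0 \<le> (\<Sum>k<n. \<Sum>l<n. (c k * c l / pi) * ?f k l z)" if z: "0 < z" for z
    proof -
      \<comment> \<open>the power of \<open>z\<close> factorises, because its exponent is a sum of a term in \<open>H (\<iota> k)\<close> and one in \<open>H (\<iota> l)\<close>\<close>
      define V where "V k = complex_of_real (c k * z powr (- H (\<iota> k) - 1 / 2)) * (1 - iexp (t k * z))" for k
      have "0 \<le> Re (\<Sum>k<n. \<Sum>l<n. cnj (V k) * Q $ \<iota> k $ \<iota> l * V l)"
        by (rule positive_semidefinite_family[OF Q])
      also have "\<dots> = (\<Sum>k<n. \<Sum>l<n. Re (cnj (V k) * Q $ \<iota> k $ \<iota> l * V l))" by simp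
      also have "\<dots> = (\<Sum>k<n. \<Sum>l<n. c k * c l * ?f k l z)"
      proof (intro sum.cong refl)
        fix k l
        have "cnj (V k) * Q $ \<iota> k $ \<iota> l * V l = complex_of_real (c k * c l * (z powr (- H (\<iota> k) - 1 / 2) * z powr (- H (\<iota> l) - 1 / 2)))
            * (cnj (1 - iexp (t k * z)) * Q $ \<iota> k $ \<iota> l * (1 - iexp (t l * z)))"
          unfolding V_def by (simp only: complex_cnj_mult complex_cnj_complex_of_real of_real_mult mult_ac)
        also have "z powr (- H (\<iota> k) - 1 / 2) * z powr (- H (\<iota> l) - 1 / 2) = z powr (- (H (\<iota> k) + H (\<iota> l)) - 1)"
          by (simp flip: powr_add add: algebra_simps)
        finally have "Re (cnj (V k) * Q $ \<iota> k $ \<iota> l * V l) = c k * c l * z powr (- (H (\<iota> k) + H (\<iota> l)) - 1)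
            * Re (cnj (1 - iexp (t k * z)) * Q $ \<iota> k $ \<iota> l * (1 - iexp (t l * z)))"
          by (simp only: re)
        then show "Re (cnj (V k) * Q $ \<iota> k $ \<iota> l * V l) = c k * c l * ?f k l z"
          by (simp only: mult_ac)
      qed
      finally have "0 \<le> (1 / pi) * (\<Sum>k<n. \<Sum>l<n. c k * c l * ?f k l z)" by simp
      also have "\<dots> = (\<Sum>k<n. \<Sum>l<n. (c k * c l / pi) * ?f k l z)"
        unfolding sum_distrib_left by (intro sum.cong refl) simp
      finally show ?thesis .
    qed
    then have "0 \<le> (\<integral>z. (\<Sum>k<n. \<Sum>l<n. (c k * c l / pi) * ?f k l z) \<partial>half_line)"
      by (intro Bochner_Integration.integral_nonneg_AE half_line_AE_I) simp
    then have "0 \<le> (\<Sum>k<n. \<Sum>l<n. u k * u l * S (t k) (t l) $ \<iota> k $ \<iota> l)"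
      using has_bochner_integral_integral_eq[OF I] by simp
    then show "0 \<le> (\<Sum>k<n. \<Sum>l<n. u k * u l * (case x k of (i, s) \<Rightarrow> \<lambda>(j, t). S s t $ i $ j) (x l))"
      by (simp add: \<iota>_def t_def split_beta)
  qed
qed (rule increment_continuous)

end

section \<open>Necessity\<close>

text \<open>
  Lists of weights and frequencies, with repetitions allowed, are closed under products without any
  merging of equal frequencies.
\<close>

definition trig_poly :: "(complex \<times> real) list \<Rightarrow> real \<Rightarrow> complex" where
  "trig_poly L x = (\<Sum>(w, t)\<leftarrow>L. w * iexp (t * x))"

lemma trig_poly_append: "trig_poly (L @ L') x = trig_poly L x + trig_poly L' x"
  by (simp add: trig_poly_def)

lemma trig_poly_modulate:
  "trig_poly (map (\<lambda>(w, t). (c * w, a + t)) L) x = c * iexp (a * x) * trig_poly L x"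
proof (induction L)
  case (Cons p L)
  have e: "iexp ((a + t) * x) = iexp (a * x) * iexp (t * x)" for t
    by (simp add: distrib_right distrib_left exp_add)
  obtain w t where p: "p = (w, t)" by force
  have "trig_poly (map (\<lambda>(w, t). (c * w, a + t)) (p # L)) x = c * w * iexp ((a + t) * x) + c * iexp (a * x) * trig_poly L x"
    using Cons by (simp only: trig_poly_def p) simp
  also have "\<dots> = c * iexp (a * x) * (w * iexp (t * x) + trig_poly L x)"
    unfolding e by (simp only: distrib_left mult_ac)
  also have "w * iexp (t * x) + trig_poly L x = trig_poly (p # L) x"
    by (simp add: trig_poly_def p)
  finally show ?case .
qed (simp add: trig_poly_def)

text \<open>
  The factor \<open>1 - iexp (b * x)\<close> vanishes at 0, as the tests of the covariance need, and tames the
  singularity of the spectral density there.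
\<close>

lemma trig_poly_cos_power:
  "\<exists>L. \<forall>x. trig_poly L x = (1 - iexp (b * x)) * complex_of_real (cos (a * (x - 1))) ^ n"
proof (induction n)
  case 0
  show ?case by (intro exI[of _ "[(1, 0), (-1, b)]"]) (simp add: trig_poly_def)
next
  case (Suc n)
  then obtain L where L: "\<And>x. trig_poly L x = (1 - iexp (b * x)) * complex_of_real (cos (a * (x - 1))) ^ n"
    by blast
  define L' where "L' = map (\<lambda>(w, t). (iexp (- a) / 2 * w, a + t)) L @ map (\<lambda>(w, t). (iexp a / 2 * w, - a + t)) L"
  have "trig_poly L' x = (1 - iexp (b * x)) * complex_of_real (cos (a * (x - 1))) ^ Suc n" for x
  proof -
    have c: "complex_of_real (cos (a * (x - 1))) = iexp (- a) / 2 * iexp (a * x) + iexp a / 2 * iexp (- a * x)"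
    proof -
      have "complex_of_real (cos (a * (x - 1))) = (iexp (a * (x - 1)) + iexp (- (a * (x - 1)))) / 2"
        by (simp add: cos_exp_eq flip: cos_of_real)
      also have "iexp (a * (x - 1)) = iexp (- a) * iexp (a * x)" by (simp add: algebra_simps flip: exp_add)
      also have "iexp (- (a * (x - 1))) = iexp a * iexp (- a * x)" by (simp add: algebra_simps flip: exp_add)
      finally show ?thesis by (simp only: add_divide_distrib times_divide_eq_left)
    qed
    have "trig_poly L' x = (iexp (- a) / 2 * iexp (a * x) + iexp a / 2 * iexp (- a * x)) * trig_poly L x"
      unfolding L'_def trig_poly_append trig_poly_modulate by (simp only: distrib_right)
    then show ?thesis unfolding L c[symmetric] power_Suc by (simp only: mult_ac)
  qed
  then show ?case by blast
qed

lemma cos_power_tendsto_gaussian: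
  fixes y :: real
  shows "(\<lambda>n. cos (y / sqrt (real n)) ^ n) \<longlonglongrightarrow> exp (- y\<^sup>2 / 2)"
proof -
  have "(\<lambda>n. cos (y / sqrt (real n)) ^ n) \<longlonglongrightarrow> exp (- (y * y) / 2)"
    by (cases y "0 :: real" rule: linorder_cases) real_asymp+
  then show ?thesis by (simp add: power2_eq_square)
qed

text \<open>
  If \<open>r 1\<close> were negative, then \<open>r \<le> - c\<close> on an interval of radius \<open>\<delta>\<close> around 1. That interval would
  contribute at most \<open>- c * \<delta> * exp (- T * (\<delta> / 2)\<^sup>2)\<close> (restrict to radius \<open>\<delta> / 2\<close>), whereas the rest
  of the integral, including the term with \<open>r'\<close>, whose Gaussian is centred at \<open>-1\<close>, is of order
  \<open>exp (- T * \<delta>\<^sup>2)\<close>, which is negligible for large \<open>T\<close>.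
\<close>

lemma concentration_nonneg:
  fixes r r' :: "real \<Rightarrow> real"
  assumes r: "integrable half_line r" and r': "integrable half_line r'" and cont: "isCont r 1"
    and nonneg: "\<And>T. 0 < T \<Longrightarrow>
      0 \<le> (\<integral>x. r x * exp (- (T * (x - 1)\<^sup>2)) + r' x * exp (- (T * (x + 1)\<^sup>2)) \<partial>half_line)"
  shows "0 \<le> r 1"
proof (rule ccontr)
  assume "\<not> 0 \<le> r 1"
  define c where "c = - r 1 / 2"
  have c: "0 < c" using \<open>\<not> 0 \<le> r 1\<close> by (simp add: c_def)
  obtain d where d: "0 < d" "\<And>x. dist x 1 < d \<Longrightarrow> dist (r x) (r 1) < c"
    using cont c unfolding continuous_at_eps_delta by (metis dist_norm)
  \<comment> \<open>\<open>\<delta> \<le> 1\<close> lets \<open>exp (- (T * \<delta>\<^sup>2))\<close> dominate the Gaussian centred at \<open>-1\<close> as well\<close>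
  define \<delta> where "\<delta> = min d 1"
  have \<delta>: "0 < \<delta>" "\<delta> \<le> 1" using d by (auto simp: \<delta>_def)
  have near: "r x \<le> - c" if "\<bar>x - 1\<bar> < \<delta>" for x
    using d(2)[of x] that unfolding \<delta>_def dist_real_def c_def by linarith
  define A where "A = {1 - \<delta> / 2<..<1 + \<delta> / 2}"
  have A: "A \<subseteq> {0<..}" "A \<in> sets borel" using \<delta> by (auto simp: A_def)
  have hA: "has_bochner_integral half_line (indicator A) \<delta>"
  proof -
    have "has_bochner_integral lborel (indicator A :: real \<Rightarrow> real) (measure lborel A)"
      by (rule has_bochner_integral_real_indicator) (use \<delta> in \<open>auto simp: A_def\<close>)
    also have "(indicator A :: real \<Rightarrow> real) = (\<lambda>x. indicator {0<..} x * indicator A x)"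
      using A(1) by (auto simp: indicator_def fun_eq_iff)
    also have "measure lborel A = \<delta>" using \<delta> by (simp add: A_def)
    finally show ?thesis unfolding has_bochner_integral_half_line .
  qed
  define K where "K = (\<integral>x. \<bar>r x\<bar> + \<bar>r' x\<bar> \<partial>half_line)"
  have bound: "c * \<delta> \<le> K * exp (- (3 * \<delta>\<^sup>2 / 4) * T)" if T: "0 < T" for T
  proof -
    have pt: "r x * exp (- (T * (x - 1)\<^sup>2)) + r' x * exp (- (T * (x + 1)\<^sup>2))
      \<le> - (c * exp (- (T * (\<delta> / 2)\<^sup>2))) * indicator A x + exp (- (T * \<delta>\<^sup>2)) * (\<bar>r x\<bar> + \<bar>r' x\<bar>)"
      if x: "0 < x" for x
    proof -
      have "1\<^sup>2 \<le> (x + 1)\<^sup>2" using x by (intro power_mono) auto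
      moreover have "\<delta>\<^sup>2 \<le> 1\<^sup>2" using \<delta> by (intro power_mono) auto
      ultimately have "\<delta>\<^sup>2 \<le> (x + 1)\<^sup>2" by linarith
      then have "exp (- (T * (x + 1)\<^sup>2)) \<le> exp (- (T * \<delta>\<^sup>2))" using T by simp
      then have "\<bar>r' x\<bar> * exp (- (T * (x + 1)\<^sup>2)) \<le> \<bar>r' x\<bar> * exp (- (T * \<delta>\<^sup>2))" by (rule mult_left_mono) simp
      with mult_right_mono[OF abs_ge_self[of "r' x"] exp_ge_zero[of "- (T * (x + 1)\<^sup>2)"]] have 2: "r' x * exp (- (T * (x + 1)\<^sup>2)) \<le> exp (- (T * \<delta>\<^sup>2)) * \<bar>r' x\<bar>"
        by (subst mult.commute[of "exp (- (T * \<delta>\<^sup>2))"]) (rule order_trans)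
      have 1: "r x * exp (- (T * (x - 1)\<^sup>2)) \<le> - (c * exp (- (T * (\<delta> / 2)\<^sup>2))) * indicator A x + exp (- (T * \<delta>\<^sup>2)) * \<bar>r x\<bar>"
      proof (cases "\<bar>x - 1\<bar> < \<delta>")
        case True
        have "r x * exp (- (T * (x - 1)\<^sup>2)) \<le> - c * exp (- (T * (x - 1)\<^sup>2))"
          by (intro mult_right_mono near True) simp
        also have "\<dots> \<le> - (c * exp (- (T * (\<delta> / 2)\<^sup>2))) * indicator A x"
        proof (cases "x \<in> A")
          case True
          then have "\<bar>x - 1\<bar> \<le> \<delta> / 2" unfolding A_def greaterThanLessThan_iff by linarith
          then have "\<bar>x - 1\<bar>\<^sup>2 \<le> (\<delta> / 2)\<^sup>2" by (intro power_mono) auto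
          then have "exp (- (T * (\<delta> / 2)\<^sup>2)) \<le> exp (- (T * (x - 1)\<^sup>2))" using T by simp
          then have "c * exp (- (T * (\<delta> / 2)\<^sup>2)) \<le> c * exp (- (T * (x - 1)\<^sup>2))" using c by (intro mult_left_mono) auto
          then show ?thesis using True by simp
        next
          case False
          then show ?thesis using c by simp
        qed
        also have "\<dots> \<le> \<dots> + exp (- (T * \<delta>\<^sup>2)) * \<bar>r x\<bar>" by simp
        finally show ?thesis .
      next
        case False
        then have "x \<notin> A" using \<delta> unfolding A_def by auto
        have "\<delta>\<^sup>2 \<le> \<bar>x - 1\<bar>\<^sup>2" using False \<delta> by (intro power_mono) auto
        then have "exp (- (T * (x - 1)\<^sup>2)) \<le> exp (- (T * \<delta>\<^sup>2))" using T by simp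
        then have "\<bar>r x\<bar> * exp (- (T * (x - 1)\<^sup>2)) \<le> \<bar>r x\<bar> * exp (- (T * \<delta>\<^sup>2))" by (rule mult_left_mono) simp
        with mult_right_mono[OF abs_ge_self[of "r x"] exp_ge_zero[of "- (T * (x - 1)\<^sup>2)"]] have "r x * exp (- (T * (x - 1)\<^sup>2)) \<le> exp (- (T * \<delta>\<^sup>2)) * \<bar>r x\<bar>"
          by (subst mult.commute[of "exp (- (T * \<delta>\<^sup>2))"]) (rule order_trans)
        then show ?thesis using \<open>x \<notin> A\<close> by simp
      qed
      from 1 2 show ?thesis by (simp add: distrib_left)
    qed
    have [measurable]: "r \<in> borel_measurable half_line" "r' \<in> borel_measurable half_line" using r r' by auto
    have i1: "integrable half_line (\<lambda>x. r x * exp (- (T * (x - 1)\<^sup>2)))"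
      using T by (intro Bochner_Integration.integrable_bound[OF r]) (auto simp: abs_mult intro!: mult_left_le)
    have i2: "integrable half_line (\<lambda>x. r' x * exp (- (T * (x + 1)\<^sup>2)))"
      using T by (intro Bochner_Integration.integrable_bound[OF r']) (auto simp: abs_mult intro!: mult_left_le)
    have i3: "integrable half_line (\<lambda>x. \<bar>r x\<bar> + \<bar>r' x\<bar>)" using r r' by simp
    have "0 \<le> (\<integral>x. r x * exp (- (T * (x - 1)\<^sup>2)) + r' x * exp (- (T * (x + 1)\<^sup>2)) \<partial>half_line)"
      by (rule nonneg[OF T])
    also have "\<dots> \<le> (\<integral>x. - (c * exp (- (T * (\<delta> / 2)\<^sup>2))) * indicator A x + exp (- (T * \<delta>\<^sup>2)) * (\<bar>r x\<bar> + \<bar>r' x\<bar>) \<partial>half_line)"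
    proof (rule integral_mono)
      show "integrable half_line (\<lambda>x. - (c * exp (- (T * (\<delta> / 2)\<^sup>2))) * indicator A x + exp (- (T * \<delta>\<^sup>2)) * (\<bar>r x\<bar> + \<bar>r' x\<bar>))"
        by (intro Bochner_Integration.integrable_add integrable_mult_right i3 integrable.intros[OF hA])
    qed (use i1 i2 pt in auto)
    also have "\<dots> = - (c * exp (- (T * (\<delta> / 2)\<^sup>2))) * \<delta> + exp (- (T * \<delta>\<^sup>2)) * K"
      unfolding K_def using i3
      by (intro has_bochner_integral_integral_eq has_bochner_integral_add has_bochner_integral_mult_right hA has_bochner_integral_integrable)
    finally have "c * \<delta> * exp (- (T * (\<delta> / 2)\<^sup>2)) \<le> K * exp (- (T * \<delta>\<^sup>2))" by (simp add: mult_ac)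
    then have "c * \<delta> * exp (- (T * (\<delta> / 2)\<^sup>2)) * exp (T * (\<delta> / 2)\<^sup>2) \<le> K * exp (- (T * \<delta>\<^sup>2)) * exp (T * (\<delta> / 2)\<^sup>2)"
      by (rule mult_right_mono) simp
    then show ?thesis by (simp add: mult.assoc power_divide algebra_simps flip: exp_add)
  qed
  have "((\<lambda>T. K * exp (- (3 * \<delta>\<^sup>2 / 4) * T)) \<longlongrightarrow> 0) at_top"
    using \<delta> by (intro tendsto_mult_right_zero) real_asymp
  moreover have "\<forall>\<^sub>F T in at_top. c * \<delta> \<le> K * exp (- (3 * \<delta>\<^sup>2 / 4) * T)"
    using eventually_gt_at_top[of 0] by eventually_elim (rule bound)
  ultimately have "c * \<delta> \<le> 0" by (intro tendsto_lowerbound) auto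
  with c \<delta> show False by (simp add: mult_le_0_iff)
qed

context mfbm_parameters
begin

definition spectral_weight :: "('n \<Rightarrow> 'n \<Rightarrow> complex) \<Rightarrow> real \<Rightarrow> real" where
  "spectral_weight a x = (\<Sum>i\<in>UNIV. \<Sum>j\<in>UNIV. Re (a i j) * x powr (- (H i + H j) - 1))"

text \<open>
  The covariance is real, so its quadratic form with complex weights is the sum of the forms
  for their real and imaginary parts. The spectral representation involves real parts as well; writing
  them as half a sum of conjugates produces a second term with the conjugate of \<open>Q\<close>, which is the
  contribution of the negative frequencies.
\<close>

lemma spectral_form_nonneg:
  fixes v :: "'n \<Rightarrow> complex"
  defines "a \<equiv> \<lambda>i j. cnj (v i) * Q $ i $ j * v j"
    and "b \<equiv> \<lambda>i j. cnj (v i) * cnj (Q $ i $ j) * v j"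
  assumes S: "covariance_matrix_function S" and L: "trig_poly L 0 = 0"
  shows "0 \<le> (\<integral>x. spectral_weight a x * (norm (trig_poly L x))\<^sup>2
                  + spectral_weight b x * (norm (trig_poly L (- x)))\<^sup>2 \<partial>half_line)"
proof -
  define N w t where "N = length L" and "w k = fst (L ! k)" and "t k = snd (L ! k)" for k
  have F: "trig_poly L x = (\<Sum>k<N. w k * iexp (t k * x))" for x
    unfolding trig_poly_def N_def w_def t_def
    by (simp add: sum_list_sum_nth split_beta lessThan_atLeast0)
  define E where "E k x = 1 - iexp (t k * x)" for k x
  \<comment> \<open>the weights sum to 0, so the constant terms of the \<open>E k\<close> cancel\<close>
  have wE: "(\<Sum>k<N. w k * E k x) = - trig_poly L x" for x
  proof -
    have "(\<Sum>k<N. w k * E k x) = trig_poly L 0 - trig_poly L x"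
      unfolding F E_def by (simp add: right_diff_distrib sum_subtractf)
    then show ?thesis using L by simp
  qed
  have cE: "cnj (E k x) = E k (- x)" for k x
    unfolding E_def by (simp add: exp_cnj)
  define c where "c k i = v i * w k / \<sigma> i" for k i
  let ?sum = "\<lambda>f. \<Sum>k<N. \<Sum>l<N. \<Sum>i\<in>UNIV. \<Sum>j\<in>UNIV. f k l i j :: real"
  let ?g = "\<lambda>k l i j x. Re (cnj (E k x) * Q $ i $ j * E l x) * x powr (- (H i + H j) - 1)"
  have "0 \<le> ?sum (\<lambda>k l i j. Re (c k i) * Re (c l j) * S (t k) (t l) $ i $ j)
      + ?sum (\<lambda>k l i j. Im (c k i) * Im (c l j) * S (t k) (t l) $ i $ j)"
    by (intro add_nonneg_nonneg covariance_matrix_function_quadratic_form[OF S]) auto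
  also have "\<dots> = ?sum (\<lambda>k l i j. Re (cnj (c k i) * c l j) * S (t k) (t l) $ i $ j)"
    by (simp only: sum.distrib[symmetric] distrib_right[symmetric]) simp
  also have "\<dots> = ?sum (\<lambda>k l i j. Re (cnj (c k i) * c l j) * (\<sigma> i * \<sigma> j / pi) * (pi / (\<sigma> i * \<sigma> j) * S (t k) (t l) $ i $ j))"
    by (intro sum.cong refl) (simp add: less_imp_neq[OF sigma, THEN not_sym])
  also have "\<dots> = (\<integral>x. ?sum (\<lambda>k l i j. Re (cnj (c k i) * c l j) * (\<sigma> i * \<sigma> j / pi) * ?g k l i j x) \<partial>half_line)"
    unfolding E_def
    by (rule has_bochner_integral_integral_eq[symmetric])
      (intro has_bochner_integral_sum has_bochner_integral_mult_right spectral_representation)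
  also have "\<dots> = (\<integral>x. (spectral_weight a x * (norm (trig_poly L x))\<^sup>2
                  + spectral_weight b x * (norm (trig_poly L (- x)))\<^sup>2) / (2 * pi) \<partial>half_line)"
  proof (intro Bochner_Integration.integral_cong refl)
    fix x
    have kl: "(\<Sum>k<N. \<Sum>l<N. Re (cnj (c k i) * c l j) * (\<sigma> i * \<sigma> j / pi) * ?g k l i j x)
        = (Re (a i j) * (norm (trig_poly L x))\<^sup>2 + Re (b i j) * (norm (trig_poly L (- x)))\<^sup>2) * x powr (- (H i + H j) - 1) / (2 * pi)" for i j
    proof -
      have form: "(\<Sum>k<N. \<Sum>l<N. Re (\<alpha> * (cnj (w k * E k y) * (w l * E l y)))) = Re \<alpha> * (norm (trig_poly L y))\<^sup>2" for \<alpha> y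
      proof -
        have "(\<Sum>k<N. \<Sum>l<N. Re (\<alpha> * (cnj (w k * E k y) * (w l * E l y)))) = Re (\<alpha> * (\<Sum>k<N. \<Sum>l<N. cnj (w k * E k y) * (w l * E l y)))"
          by (simp only: Re_sum sum_distrib_left)
        also have "(\<Sum>k<N. \<Sum>l<N. cnj (w k * E k y) * (w l * E l y)) = cnj (\<Sum>k<N. w k * E k y) * (\<Sum>l<N. w l * E l y)"
          by (simp only: cnj_sum sum_product)
        also have "\<dots> = complex_of_real ((norm (trig_poly L y))\<^sup>2)"
          unfolding wE complex_norm_square complex_cnj_minus minus_mult_minus by (rule mult.commute)
        finally show ?thesis by simp
      qed
      have pt: "Re (cnj (c k i) * c l j) * (\<sigma> i * \<sigma> j / pi) * ?g k l i j x
         = (Re (a i j * (cnj (w k * E k x) * (w l * E l x))) + Re (b i j * (cnj (w k * E k (- x)) * (w l * E l (- x)))))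
            * (x powr (- (H i + H j) - 1) / (2 * pi))" for k l
      proof -
        have half: "Re z * Re z' = (Re (z * z') + Re (z * cnj z')) / 2" for z z' by simp
        have "Re (cnj (c k i) * c l j) * (\<sigma> i * \<sigma> j) = Re (cnj (v i * w k) * (v j * w l))"
          using less_imp_neq[OF sigma, THEN not_sym, of i] less_imp_neq[OF sigma, THEN not_sym, of j]
          unfolding c_def by (simp add: field_simps)
        then have "Re (cnj (c k i) * c l j) * (\<sigma> i * \<sigma> j / pi) * ?g k l i j x
           = (Re (cnj (v i * w k) * (v j * w l)) * Re (cnj (E k x) * Q $ i $ j * E l x)) * (x powr (- (H i + H j) - 1) / pi)"
          by (simp only: times_divide_eq_right times_divide_eq_left mult_ac)
        also have "Re (cnj (v i * w k) * (v j * w l)) * Re (cnj (E k x) * Q $ i $ j * E l x)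
           = (Re (cnj (v i * w k) * (v j * w l) * (cnj (E k x) * Q $ i $ j * E l x))
              + Re (cnj (v i * w k) * (v j * w l) * cnj (cnj (E k x) * Q $ i $ j * E l x))) / 2"
          by (rule half)
        also have "cnj (v i * w k) * (v j * w l) * (cnj (E k x) * Q $ i $ j * E l x) = a i j * (cnj (w k * E k x) * (w l * E l x))"
          unfolding a_def by (simp only: complex_cnj_mult mult_ac)
        also have "cnj (v i * w k) * (v j * w l) * cnj (cnj (E k x) * Q $ i $ j * E l x) = b i j * (cnj (w k * E k (- x)) * (w l * E l (- x)))"
          unfolding b_def by (simp only: complex_cnj_mult complex_cnj_cnj cE minus_minus mult_ac)
        finally show ?thesis by simp
      qed
      show ?thesis unfolding pt sum_distrib_right[symmetric] sum.distrib form by simp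
    qed
    have "?sum (\<lambda>k l i j. Re (cnj (c k i) * c l j) * (\<sigma> i * \<sigma> j / pi) * ?g k l i j x)
       = (\<Sum>k<N. \<Sum>i\<in>UNIV. \<Sum>j\<in>UNIV. \<Sum>l<N. Re (cnj (c k i) * c l j) * (\<sigma> i * \<sigma> j / pi) * ?g k l i j x)"
      by (intro sum.cong refl, subst sum.swap, intro sum.cong refl, rule sum.swap)
    also have "\<dots> = (\<Sum>i\<in>UNIV. \<Sum>j\<in>UNIV. \<Sum>k<N. \<Sum>l<N. Re (cnj (c k i) * c l j) * (\<sigma> i * \<sigma> j / pi) * ?g k l i j x)"
      by (subst sum.swap, intro sum.cong refl, rule sum.swap)
    also have "\<dots> = (\<Sum>i\<in>UNIV. \<Sum>j\<in>UNIV. (Re (a i j) * (norm (trig_poly L x))\<^sup>2 + Re (b i j) * (norm (trig_poly L (- x)))\<^sup>2)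
        * x powr (- (H i + H j) - 1) / (2 * pi))"
      unfolding kl ..
    also have "\<dots> = (spectral_weight a x * (norm (trig_poly L x))\<^sup>2 + spectral_weight b x * (norm (trig_poly L (- x)))\<^sup>2) / (2 * pi)"
      unfolding spectral_weight_def sum_distrib_right sum.distrib[symmetric] sum_divide_distrib
      by (intro sum.cong refl) (simp add: algebra_simps)
    finally show "?sum (\<lambda>k l i j. Re (cnj (c k i) * c l j) * (\<sigma> i * \<sigma> j / pi) * ?g k l i j x)
       = (spectral_weight a x * (norm (trig_poly L x))\<^sup>2 + spectral_weight b x * (norm (trig_poly L (- x)))\<^sup>2) / (2 * pi)" .
  qed
  finally show ?thesis using pi_gt_zero by (simp add: zero_le_divide_iff)
qed

end

context mfbm_parameters
begin

text \<open>
  At \<open>x = 1\<close> all powers of \<open>x\<close> are 1, so the spectral density there is the form of \<open>Q\<close> itself, up to the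
  factor \<open>\<bar>1 - exp (i pi)\<bar>\<^sup>2 = 4\<close>.
\<close>

lemma spectral_form_at_1_nonneg:
  fixes v :: "'n \<Rightarrow> complex"
  assumes S: "covariance_matrix_function S"
  shows "0 \<le> Re (\<Sum>i\<in>UNIV. \<Sum>j\<in>UNIV. cnj (v i) * Q $ i $ j * v j)"
proof -
  define a b where "a i j = cnj (v i) * Q $ i $ j * v j" and "b i j = cnj (v i) * cnj (Q $ i $ j) * v j" for i j
  define r where "r c x = 2 * (1 - cos (pi * x)) * spectral_weight c x" for c x
  have r_int: "integrable half_line (r c)" for c
  proof -
    have "integrable half_line (\<lambda>x. \<Sum>i\<in>UNIV. \<Sum>j\<in>UNIV. 2 * Re (c i j) * ((1 - cos (pi * x)) * x powr (- (H i + H j) - 1)))"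
      using cos_power_integral[OF exponent_bounds, of pi]
      by (intro Bochner_Integration.integrable_sum integrable_mult_right) (auto simp: has_bochner_integral_iff)
    also have "(\<lambda>x. \<Sum>i\<in>UNIV. \<Sum>j\<in>UNIV. 2 * Re (c i j) * ((1 - cos (pi * x)) * x powr (- (H i + H j) - 1))) = r c"
      unfolding r_def spectral_weight_def sum_distrib_left by (intro ext sum.cong refl) (simp only: mult_ac)
    finally show ?thesis .
  qed
  have "0 \<le> r a 1"
  proof (rule concentration_nonneg[OF r_int r_int[of b]])
    show "isCont (r a) 1"
      unfolding r_def spectral_weight_def by (intro continuous_intros) auto
    fix T :: real assume T: "0 < T"
    define g where "g n y = cos (sqrt T / sqrt (real n) * y) ^ n" for n and y :: real
    have glim: "(\<lambda>n. (g n y)\<^sup>2) \<longlonglongrightarrow> exp (- (T * y\<^sup>2))" for y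
    proof -
      have "(\<lambda>n. (cos (sqrt T * y / sqrt (real n)) ^ n)\<^sup>2) \<longlonglongrightarrow> (exp (- (sqrt T * y)\<^sup>2 / 2))\<^sup>2"
        by (intro tendsto_power cos_power_tendsto_gaussian)
      moreover have "(exp (- (sqrt T * y)\<^sup>2 / 2))\<^sup>2 = exp (- (T * y\<^sup>2))"
        using T by (simp add: power_mult_distrib flip: exp_double)
      ultimately show ?thesis unfolding g_def by (simp add: mult.commute)
    qed
    have gle: "(g n y)\<^sup>2 \<le> 1" for n y
    proof -
      have "\<bar>g n y\<bar> \<le> 1" unfolding g_def power_abs by (intro power_le_one) auto
      then show ?thesis by (simp add: abs_square_le_1)
    qed
    have gm [measurable]: "(\<lambda>x. g n (x + z)) \<in> borel_measurable half_line" "(\<lambda>x. g n (x - z)) \<in> borel_measurable half_line" for n z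
      unfolding g_def by measurable
    have rm [measurable]: "r c \<in> borel_measurable half_line" for c using r_int[of c] by auto
    let ?I = "\<lambda>n x. r a x * (g n (x - 1))\<^sup>2 + r b x * (g n (x + 1))\<^sup>2"
    have "(\<lambda>n. \<integral>x. ?I n x \<partial>half_line) \<longlonglongrightarrow> (\<integral>x. r a x * exp (- (T * (x - 1)\<^sup>2)) + r b x * exp (- (T * (x + 1)\<^sup>2)) \<partial>half_line)"
    proof (rule integral_dominated_convergence[where w = "\<lambda>x. \<bar>r a x\<bar> + \<bar>r b x\<bar>"])
      show "integrable half_line (\<lambda>x. \<bar>r a x\<bar> + \<bar>r b x\<bar>)" using r_int by simp
      show "AE x in half_line. (\<lambda>n. ?I n x) \<longlonglongrightarrow> r a x * exp (- (T * (x - 1)\<^sup>2)) + r b x * exp (- (T * (x + 1)\<^sup>2))"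
        by (intro AE_I2 tendsto_intros glim)
      show "AE x in half_line. norm (?I n x) \<le> \<bar>r a x\<bar> + \<bar>r b x\<bar>" for n
      proof (rule AE_I2)
        fix x
        have "\<bar>r c x * (g n y)\<^sup>2\<bar> \<le> \<bar>r c x\<bar>" for c y
          using gle[of n y] by (simp add: abs_mult mult_left_le)
        from add_mono[OF this[of a "x - 1"] this[of b "x + 1"]]
        show "norm (?I n x) \<le> \<bar>r a x\<bar> + \<bar>r b x\<bar>"
          unfolding real_norm_def by (rule order_trans[OF abs_triangle_ineq])
      qed
    qed measurable
    moreover have "0 \<le> (\<integral>x. ?I n x \<partial>half_line)" for n
    proof -
      obtain L where L: "\<And>x. trig_poly L x = (1 - iexp (pi * x)) * complex_of_real (cos (sqrt T / sqrt (real n) * (x - 1))) ^ n"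
        using trig_poly_cos_power by blast
      have n2: "(norm (trig_poly L x))\<^sup>2 = 2 * (1 - cos (pi * x)) * (g n (x - 1))\<^sup>2" for x
      proof -
        have "(norm (trig_poly L x))\<^sup>2 = (norm (1 - iexp (pi * x)))\<^sup>2 * (g n (x - 1))\<^sup>2"
          unfolding L g_def norm_mult norm_power norm_of_real power_mult_distrib
          by (simp only: power_even_abs even_numeral power_mult[symmetric] mult.commute[of n]) (simp add: power_mult)
        then show ?thesis unfolding norm_one_minus_iexp .
      qed
      have gneg: "(g n (- x - 1))\<^sup>2 = (g n (x + 1))\<^sup>2" for x
      proof -
        have "- x - 1 = - (x + 1)" by simp
        then show ?thesis unfolding g_def by (simp only: mult_minus_right cos_minus)
      qed
      have "0 \<le> (\<integral>x. spectral_weight a x * (norm (trig_poly L x))\<^sup>2 + spectral_weight b x * (norm (trig_poly L (- x)))\<^sup>2 \<partial>half_line)"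
        unfolding a_def b_def by (rule spectral_form_nonneg[OF S]) (simp add: L)
      also have "\<dots> = (\<integral>x. ?I n x \<partial>half_line)"
        unfolding n2 gneg r_def mult_minus_right cos_minus by (simp only: mult_ac)
      finally show ?thesis .
    qed
    ultimately show "0 \<le> (\<integral>x. r a x * exp (- (T * (x - 1)\<^sup>2)) + r b x * exp (- (T * (x + 1)\<^sup>2)) \<partial>half_line)"
      using LIMSEQ_le_const by blast
  qed
  also have "r a 1 = 4 * Re (\<Sum>i\<in>UNIV. \<Sum>j\<in>UNIV. a i j)"
    by (simp add: r_def spectral_weight_def)
  finally show ?thesis by (simp add: a_def)
qed

lemma covariance_iff_positive_semidefinite:
  "covariance_matrix_function S \<longleftrightarrow> positive_semidefinite Q"
  using covariance_if_positive_semidefinite spectral_form_at_1_nonneg Q_hermitian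
  unfolding positive_semidefinite_def by blast

end


section \<open>Two components\<close>

text \<open>
  Among the vectors whose second entry is \<open>\<alpha>\<close>, the one with first entry \<open>- A $ a $ b\<close> minimises the
  form, and the minimum is \<open>\<alpha>\<close> times the determinant. Conversely, the form is bounded below by the
  square of \<open>sqrt \<alpha> * norm (v $ a) - sqrt \<beta> * norm (v $ b)\<close> if the determinant is nonnegative.
\<close>

lemma positive_semidefinite_2:
  fixes A :: "complex ^ 'n::finite ^ 'n"
  assumes two: "(UNIV :: 'n set) = {a, b}" "a \<noteq> b" and A: "hermitian A"
    and aa: "A $ a $ a = complex_of_real \<alpha>" "0 < \<alpha>" and bb: "A $ b $ b = complex_of_real \<beta>" "0 < \<beta>"
  shows "positive_semidefinite A \<longleftrightarrow> (norm (A $ a $ b))\<^sup>2 \<le> \<alpha> * \<beta>"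
proof -
  define c where "c = A $ a $ b"
  have ba: "A $ b $ a = cnj c" using A unfolding hermitian_def c_def by blast
  have form: "Re (\<Sum>i\<in>UNIV. \<Sum>j\<in>UNIV. cnj (v $ i) * A $ i $ j * v $ j)
      = \<alpha> * (norm (v $ a))\<^sup>2 + \<beta> * (norm (v $ b))\<^sup>2 + 2 * Re (cnj (v $ a) * c * v $ b)" for v :: "complex ^ 'n"
  proof -
    have sq: "Re (cnj z * complex_of_real x * z) = x * (norm z)\<^sup>2" for z x
      by (simp add: cmod_power2) (simp add: algebra_simps power2_eq_square)
    have "Re (cnj (v $ b) * cnj c * v $ a) = Re (cnj (cnj (v $ b) * cnj c * v $ a))" by (simp only: cnj.sel)
    also have "cnj (cnj (v $ b) * cnj c * v $ a) = cnj (v $ a) * c * v $ b" by (simp only: complex_cnj_mult complex_cnj_cnj mult_ac)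
    finally show ?thesis
      unfolding two(1) using two(2) by (simp add: sq aa bb ba c_def[symmetric] del: times_complex.sel)
  qed
  show ?thesis
  proof
    assume psd: "positive_semidefinite A"
    define v :: "complex ^ 'n" where "v = (\<chi> i. if i = a then - c else complex_of_real \<alpha>)"
    have v: "v $ a = - c" "v $ b = complex_of_real \<alpha>" using two(2) by (simp_all add: v_def)
    have "0 \<le> \<alpha> * (norm (v $ a))\<^sup>2 + \<beta> * (norm (v $ b))\<^sup>2 + 2 * Re (cnj (v $ a) * c * v $ b)"
      using psd unfolding positive_semidefinite_def form by blast
    also have "\<dots> = \<alpha> * (\<alpha> * \<beta> - (norm c)\<^sup>2)"
      unfolding v by (simp add: cmod_power2) (simp add: algebra_simps power2_eq_square)
    finally show "(norm (A $ a $ b))\<^sup>2 \<le> \<alpha> * \<beta>" using aa(2) by (simp add: zero_le_mult_iff c_def)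
  next
    assume le: "(norm (A $ a $ b))\<^sup>2 \<le> \<alpha> * \<beta>"
    have nc: "norm c \<le> sqrt \<alpha> * sqrt \<beta>"
      using real_le_rsqrt[of "norm c" "\<alpha> * \<beta>"] le by (simp add: c_def real_sqrt_mult)
    have "0 \<le> \<alpha> * (norm (v $ a))\<^sup>2 + \<beta> * (norm (v $ b))\<^sup>2 + 2 * Re (cnj (v $ a) * c * v $ b)" for v
    proof -
      define x y where "x = norm (v $ a)" and "y = norm (v $ b)"
      have "- Re (cnj (v $ a) * c * v $ b) \<le> norm (cnj (v $ a) * c * v $ b)"
        using abs_Re_le_cmod[of "cnj (v $ a) * c * v $ b"] by linarith
      also have "\<dots> = x * norm c * y" by (simp add: norm_mult x_def y_def)
      also have "\<dots> \<le> x * (sqrt \<alpha> * sqrt \<beta>) * y"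
        using nc by (intro mult_right_mono mult_left_mono) (auto simp: x_def y_def)
      finally have 1: "- Re (cnj (v $ a) * c * v $ b) \<le> x * (sqrt \<alpha> * sqrt \<beta>) * y" .
      have "0 \<le> (sqrt \<alpha> * x - sqrt \<beta> * y)\<^sup>2" by simp
      also have "\<dots> = \<alpha> * x\<^sup>2 + \<beta> * y\<^sup>2 - 2 * (x * (sqrt \<alpha> * sqrt \<beta>) * y)"
        using aa(2) bb(2) by (simp add: power2_diff power_mult_distrib)
      finally show ?thesis using 1 unfolding x_def[symmetric] y_def[symmetric] by linarith
    qed
    then show "positive_semidefinite A" using A unfolding positive_semidefinite_def form by blast
  qed
qed

context mfbm_parameters
begin

text \<open>
  The number \<open>mfbm_C H \<rho> \<eta> \<rho>' \<eta>' a b\<close> is \<open>(norm (Q $ a $ b))\<^sup>2\<close> divided by the product of the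
  diagonal entries of \<open>Q\<close>.
\<close>

lemma positive_semidefinite_2_iff_C_le_1:
  assumes two: "CARD('n) = 2" and ab: "a \<noteq> b"
  shows "positive_semidefinite Q \<longleftrightarrow> mfbm_C H \<rho> \<eta> \<rho>' \<eta>' a b \<le> 1"
proof -
  have U: "(UNIV :: 'n set) = {a, b}"
    using two ab by (intro card_subset_eq[symmetric]) auto
  define q where "q i = Gamma (2 * H i + 1) * sin (pi * H i)" for i
  have Gp: "0 < Gamma (2 * H i + 1)" for i using H[of i] by (intro Gamma_real_pos) auto
  have sp: "0 < sin (pi * H i)" for i using H[of i] by (intro sin_gt_zero) auto
  have q: "Q $ i $ i = complex_of_real (q i)" "0 < q i" for i
  proof -
    show "0 < q i" unfolding q_def by (intro mult_pos_pos Gp sp)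
    show "Q $ i $ i = complex_of_real (q i)"
    proof (cases "2 * H i = 1")
      case True
      then have "pi * H i = pi / 2" by simp
      then have "sin (pi * H i) = 1" by (simp only: sin_pi_half)
      then show ?thesis using True diag'[OF True] by (simp add: mfbm_Q_def mfbm_tau_def q_def)
    next
      case False
      then show ?thesis using diag[OF False] by (simp add: mfbm_Q_def mfbm_tau_def q_def flip: mult_2)
    qed
  qed
  define N where "N = (if H a + H b \<noteq> 1 then
         (\<rho> a b)\<^sup>2 * (sin (pi / 2 * (H a + H b)))\<^sup>2 + (\<eta> a b)\<^sup>2 * (cos (pi / 2 * (H a + H b)))\<^sup>2
       else (\<rho>' a b)\<^sup>2 + pi\<^sup>2 / 4 * (\<eta>' a b)\<^sup>2)"
  have nt: "(norm (complex_of_real x - \<i> * complex_of_real y))\<^sup>2 = x\<^sup>2 + y\<^sup>2" for x y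
    by (simp add: cmod_power2)
  have "(norm (mfbm_tau H \<rho> \<eta> \<rho>' \<eta>' a b))\<^sup>2 = N"
  proof (cases "H a + H b = 1")
    case True
    have "(2 :: real)\<^sup>2 = 4" by simp
    with True show ?thesis
      unfolding mfbm_tau_def N_def by (simp only: simp_thms if_False nt power_mult_distrib power_divide)
  next
    case False
    then show ?thesis
      unfolding mfbm_tau_def N_def by (simp only: simp_thms if_True nt power_mult_distrib)
  qed
  then have n: "(norm (Q $ a $ b))\<^sup>2 = (Gamma (H a + H b + 1))\<^sup>2 * N"
    by (simp add: mfbm_Q_def norm_mult power_mult_distrib)
  have "mfbm_C H \<rho> \<eta> \<rho>' \<eta>' a b = (Gamma (H a + H b + 1))\<^sup>2 / (Gamma (2 * H a + 1) * Gamma (2 * H b + 1)) * (N / (sin (pi * H a) * sin (pi * H b)))"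
    unfolding mfbm_C_def N_def ..
  also have "\<dots> = (Gamma (H a + H b + 1))\<^sup>2 * N / (q a * q b)"
    unfolding q_def by (simp only: times_divide_times_eq mult_ac)
  finally have C: "mfbm_C H \<rho> \<eta> \<rho>' \<eta>' a b = (norm (Q $ a $ b))\<^sup>2 / (q a * q b)" unfolding n .
  have "0 < q a * q b" using q(2) by (intro mult_pos_pos)
  then have "mfbm_C H \<rho> \<eta> \<rho>' \<eta>' a b \<le> 1 \<longleftrightarrow> (norm (Q $ a $ b))\<^sup>2 \<le> q a * q b"
    unfolding C by (simp add: pos_divide_le_eq)
  then show ?thesis
    using positive_semidefinite_2[OF U ab Q_hermitian q(1) q(2) q(1) q(2)] by simp
qed

end

theorem proposition9:
  fixes H \<sigma> :: "'n::finite \<Rightarrow> real"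
    and \<rho> \<eta> \<rho>' \<eta>' :: "'n \<Rightarrow> 'n \<Rightarrow> real"
  assumes H: "\<And>i. 0 < H i \<and> H i < 1"
    and sigma: "\<And>i. 0 < \<sigma> i"
    and rho: "\<And>i j. H i + H j \<noteq> 1 \<Longrightarrow> -1 \<le> \<rho> i j \<and> \<rho> i j \<le> 1 \<and> \<rho> j i = \<rho> i j"
    and eta: "\<And>i j. H i + H j \<noteq> 1 \<Longrightarrow> \<eta> j i = - \<eta> i j"
    and rho': "\<And>i j. H i + H j = 1 \<Longrightarrow> -1 \<le> \<rho>' i j \<and> \<rho>' i j \<le> 1 \<and> \<rho>' j i = \<rho>' i j"
    and eta': "\<And>i j. H i + H j = 1 \<Longrightarrow> \<eta>' j i = - \<eta>' i j"
    and diag: "\<And>i. 2 * H i \<noteq> 1 \<Longrightarrow> \<rho> i i = 1 \<and> \<eta> i i = 0"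
    and diag': "\<And>i. 2 * H i = 1 \<Longrightarrow> \<rho>' i i = 1 \<and> \<eta>' i i = 0"
  shows "hermitian (mfbm_Q H \<rho> \<eta> \<rho>' \<eta>')
    \<and> (covariance_matrix_function (mfbm_cov H \<sigma> \<rho> \<eta> \<rho>' \<eta>')
         \<longleftrightarrow> positive_semidefinite (mfbm_Q H \<rho> \<eta> \<rho>' \<eta>'))
    \<and> (CARD('n) = 2 \<longrightarrow>
         (\<forall>a b. a \<noteq> b \<longrightarrow>
            (positive_semidefinite (mfbm_Q H \<rho> \<eta> \<rho>' \<eta>') \<longleftrightarrow> mfbm_C H \<rho> \<eta> \<rho>' \<eta>' a b \<le> 1)))"
proof -
  interpret mfbm_parameters H \<sigma> \<rho> \<eta> \<rho>' \<eta>'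
    by unfold_locales
      (use H in blast, rule sigma, use rho in blast, rule eta, assumption, use rho' in blast,
       rule eta', assumption, rule diag, assumption, rule diag', assumption)
  show ?thesis
    using Q_hermitian covariance_iff_positive_semidefinite positive_semidefinite_2_iff_C_le_1 by blast
qed

end
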